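(* Let $a,p,k,\lambda,\mu$ be integers with $a>1$, $p\geq 1$, $k\geq 1$, $\lambda\geq 0$, $\mu\geq 1$ and $\lambda\neq\mu$. Let $G=K(a^{(p)};\lambda,\mu)$, let a $k$-edge-coloring of $G$ be given, and let $\omega_j=\omega(G(j))$ for $1\leq j\leq k$. Then the $k$-edge-coloring of $G$ can be embedded into a Hamiltonian decomposition of $K(a^{(p+1)};\lambda,\mu)$ if and only if all of the following hold: (i) $k=\big(\lambda(a-1)+\mu ap\big)/2$; (ii) $\lambda\leq\mu ap$; (iii) every component of $G(j)$ is a path (possibly of length $0$) for $1\leq j\leq k$; and (iv) $\omega_j\leq a$ for $1\leq j\leq k$.
   Context: $K(a^{(p)};\lambda,\mu)$ denotes the loopless multigraph whose vertex set is partitioned into $p$ parts, each of size $a$, in which every two distinct vertices in the same part are joined by exactly $\lambda$ edges and every two vertices in different parts are joined by exactly $\mu$ edges. $K(a^{(p)};\lambda,\mu)$ is regarded as the subgraph of $K(a^{(p+1)};\lambda,\mu)$ induced by the vertices of $p$ of its $p+1$ parts. A $k$-edge-coloring of a graph $G$ is a map $E(G)\to\{1,\dots,k\}$ (no properness is required; it need not be surjective). $G(j)$ is the spanning subgraph of $G$ with vertex set $V(G)$ and edge set the edges colored $j$ (so vertices incident with no edge of color $j$ are components of $G(j)$, i.e. paths of length $0$). $\omega(H)$ denotes the number of connected components of a graph $H$. A Hamiltonian decomposition of a graph is a partition of its edge set into edge sets of Hamiltonian cycles. A $k$-edge-coloring of $G$ is embedded into a Hamiltonian decomposition of a supergraph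 $G^*$ if it extends to a $k$-edge-coloring of $G^*$ (edges of $G$ keep their colors) in which each of the $k$ color classes is a Hamiltonian cycle of $G^*$. *)

theory Defs
  imports Complex_Main
begin

(* Edges are objects of their own, so parallel edges are distinct elements of "edges". *)
record ('v, 'e) multigraph =
  verts :: "'v set"
  edges :: "'e set"
  ends  :: "'e \<Rightarrow> 'v set"

definition loopless_multigraph :: "('v, 'e) multigraph \<Rightarrow> bool" where
  "loopless_multigraph G \<longleftrightarrow>
     finite (verts G) \<and> finite (edges G) \<and>
     (\<forall>e\<in>edges G. ends G e \<subseteq> verts G \<and> card (ends G e) = 2)"

definition induced_subgraph :: "('v, 'e) multigraph \<Rightarrow> 'v set \<Rightarrow> ('v, 'e) multigraph" where
  "induced_subgraph G U =
     \<lparr>verts = verts G \<inter> U, edges = {e \<in> edges G. ends G e \<subseteq> U}, ends = ends G\<rparr>"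

definition connected_in :: "('v, 'e) multigraph \<Rightarrow> ('v \<times> 'v) set" where
  "connected_in G =
     {(u, v). u \<in> verts G \<and> v \<in> verts G \<and>
              (u, v) \<in> {(x, y). \<exists>e\<in>edges G. ends G e = {x, y}}\<^sup>*}"

definition components :: "('v, 'e) multigraph \<Rightarrow> ('v, 'e) multigraph set" where
  "components G = induced_subgraph G ` (verts G // connected_in G)"

definition num_components :: "('v, 'e) multigraph \<Rightarrow> nat" where
  "num_components G = card (components G)"

(* A single vertex (vs = [v], es = []) is a path of length 0. *)
definition is_path :: "('v, 'e) multigraph \<Rightarrow> bool" where
  "is_path H \<longleftrightarrow>
     (\<exists>vs es. distinct vs \<and> distinct es \<and> length vs = Suc (length es) \<and>
        verts H = set vs \<and> edges H = set es \<and>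
        (\<forall>i<length es. ends H (es ! i) = {vs ! i, vs ! Suc i}))"

(* Two vertices joined by exactly two parallel edges form a cycle of length 2. *)
definition is_cycle :: "('v, 'e) multigraph \<Rightarrow> bool" where
  "is_cycle H \<longleftrightarrow>
     (\<exists>vs es. distinct vs \<and> distinct es \<and> length vs = length es \<and> 2 \<le> length es \<and>
        verts H = set vs \<and> edges H = set es \<and>
        (\<forall>i<length es. ends H (es ! i) = {vs ! i, vs ! (Suc i mod length es)}))"

definition edge_coloring :: "('v, 'e) multigraph \<Rightarrow> nat \<Rightarrow> ('e \<Rightarrow> nat) \<Rightarrow> bool" where
  "edge_coloring G k c \<longleftrightarrow> (\<forall>e\<in>edges G. c e \<in> {1..k})"

definition color_class :: "('v, 'e) multigraph \<Rightarrow> ('e \<Rightarrow> nat) \<Rightarrow> nat \<Rightarrow> ('v, 'e) multigraph" where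
  "color_class G c j = \<lparr>verts = verts G, edges = {e \<in> edges G. c e = j}, ends = ends G\<rparr>"

(* A color class spans all vertices of the graph, so it is a Hamiltonian cycle
   exactly when it is a cycle. *)
definition hamiltonian_decomposition ::
    "('v, 'e) multigraph \<Rightarrow> nat \<Rightarrow> ('e \<Rightarrow> nat) \<Rightarrow> bool" where
  "hamiltonian_decomposition G k c \<longleftrightarrow>
     edge_coloring G k c \<and> (\<forall>j\<in>{1..k}. is_cycle (color_class G c j))"

definition embeddable ::
    "('v, 'e) multigraph \<Rightarrow> nat \<Rightarrow> ('e \<Rightarrow> nat) \<Rightarrow> ('v, 'e) multigraph \<Rightarrow> bool" where
  "embeddable G k c G' \<longleftrightarrow>
     (\<exists>c'. hamiltonian_decomposition G' k c' \<and> (\<forall>e\<in>edges G. c' e = c e))"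

(* K(a^(p); lam, mu): the vertex (i, x) is the x-th vertex of part i, and the edge
   ({u, v}, n) is the n-th of the parallel edges joining u and v. *)
definition K :: "nat \<Rightarrow> nat \<Rightarrow> nat \<Rightarrow> nat \<Rightarrow> (nat \<times> nat, (nat \<times> nat) set \<times> nat) multigraph" where
  "K a p lam mu =
     \<lparr>verts = {..<p} \<times> {..<a},
      edges = {({u, v}, n) | u v n. u \<in> {..<p} \<times> {..<a} \<and> v \<in> {..<p} \<times> {..<a} \<and> u \<noteq> v \<and>
                 n < (if fst u = fst v then lam else mu)},
      ends = fst\<rparr>"

lemma edges_K_iff:
  "e \<in> edges (K a p lam mu) \<longleftrightarrow>
     (\<exists>u\<in>verts (K a p lam mu). \<exists>v\<in>verts (K a p lam mu). \<exists>n.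
        e = ({u, v}, n) \<and> u \<noteq> v \<and> n < (if fst u = fst v then lam else mu))"
  unfolding K_def multigraph.simps by blast

lemma loopless_multigraph_K: "loopless_multigraph (K a p lam mu)"
proof -
  have fin: "finite (verts (K a p lam mu))"
    by (simp add: K_def)
  have ends: "ends (K a p lam mu) = fst"
    by (simp add: K_def)
  have "e \<in> Pow (verts (K a p lam mu)) \<times> {..<max lam mu}" if "e \<in> edges (K a p lam mu)" for e
  proof -
    from that obtain u v n where "u \<in> verts (K a p lam mu)" "v \<in> verts (K a p lam mu)"
        "e = ({u, v}, n)" "n < (if fst u = fst v then lam else mu)"
      unfolding edges_K_iff by blast
    then show ?thesis
      by (cases "fst u = fst v") simp_all
  qed
  then have "edges (K a p lam mu) \<subseteq> Pow (verts (K a p lam mu)) \<times> {..<max lam mu}"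
    by (rule subsetI)
  then have "finite (edges (K a p lam mu))"
    by (rule finite_subset) (intro finite_SigmaI finite_lessThan finite_Pow_iff[THEN iffD2] fin)
  moreover have "fst e \<subseteq> verts (K a p lam mu) \<and> card (fst e) = 2"
    if "e \<in> edges (K a p lam mu)" for e
  proof -
    from that obtain u v n where "u \<in> verts (K a p lam mu)" "v \<in> verts (K a p lam mu)"
        "e = ({u, v}, n)" "u \<noteq> v"
      unfolding edges_K_iff by blast
    then show ?thesis
      by simp
  qed
  ultimately show ?thesis
    using fin unfolding loopless_multigraph_def ends by blast
qed

lemma card_edges_between_K:
  assumes "u \<in> verts (K a p lam mu)" "v \<in> verts (K a p lam mu)" "u \<noteq> v"
  shows "card {e \<in> edges (K a p lam mu). ends (K a p lam mu) e = {u, v}} =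
           (if fst u = fst v then lam else mu)"
proof -
  have ends: "ends (K a p lam mu) = fst"
    by (simp add: K_def)
  have "e \<in> edges (K a p lam mu) \<and> fst e = {u, v} \<longleftrightarrow>
          e \<in> Pair {u, v} ` {..<(if fst u = fst v then lam else mu)}" (is "?L \<longleftrightarrow> ?R") for e
  proof
    assume ?L
    then obtain x y n where e: "e = ({x, y}, n)" "n < (if fst x = fst y then lam else mu)"
        and xy: "{x, y} = {u, v}"
      unfolding edges_K_iff by force
    from xy have "(fst x = fst y) = (fst u = fst v)"
      unfolding doubleton_eq_iff by metis
    with e(2) have "n \<in> {..<(if fst u = fst v then lam else mu)}"
      by simp
    then show ?R
      unfolding e(1) xy by (rule imageI)
  next
    assume ?R
    then obtain n where e: "e = ({u, v}, n)" and n: "n < (if fst u = fst v then lam else mu)"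
      unfolding image_iff lessThan_iff by blast
    have "e \<in> edges (K a p lam mu)"
      unfolding edges_K_iff using assms e n by blast
    then show ?L
      using e by simp
  qed
  then have "{e \<in> edges (K a p lam mu). fst e = {u, v}} =
          Pair {u, v} ` {..<(if fst u = fst v then lam else mu)}"
    by blast
  then show ?thesis
    unfolding ends by (simp add: card_image inj_on_def)
qed

lemma K_induced_subgraph:
  "K a p lam mu = induced_subgraph (K a (Suc p) lam mu) ({..<p} \<times> {..<a})"
proof -
  have verts: "verts (K a p lam mu) = {..<p} \<times> {..<a}" for p
    by (simp add: K_def)
  have sub: "{..<p} \<times> {..<a} \<subseteq> {..<Suc p} \<times> {..<a}"
    by auto
  have "e \<in> edges (K a p lam mu) \<longleftrightarrow>
          e \<in> edges (K a (Suc p) lam mu) \<and> fst e \<subseteq> {..<p} \<times> {..<a}" (is "?L \<longleftrightarrow> ?R") for e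
  proof
    assume ?L
    then obtain u v n where "u \<in> {..<p} \<times> {..<a}" "v \<in> {..<p} \<times> {..<a}"
        "e = ({u, v}, n)" "u \<noteq> v" "n < (if fst u = fst v then lam else mu)"
      unfolding edges_K_iff verts by blast
    moreover from this have "fst e \<subseteq> {..<p} \<times> {..<a}"
      by simp
    ultimately show ?R
      unfolding edges_K_iff verts using sub by blast
  next
    assume ?R
    then obtain u v n where e: "e = ({u, v}, n)" "u \<noteq> v"
        "n < (if fst u = fst v then lam else mu)" and "fst e \<subseteq> {..<p} \<times> {..<a}"
      unfolding edges_K_iff by blast
    then have "u \<in> {..<p} \<times> {..<a}" "v \<in> {..<p} \<times> {..<a}"
      unfolding e(1) fst_conv by blast+
    with e show ?L
      unfolding edges_K_iff verts by blast
  qed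
  then have "edges (K a p lam mu) =
      {e \<in> edges (K a (Suc p) lam mu). fst e \<subseteq> {..<p} \<times> {..<a}}"
    by blast
  moreover have "verts (K a p lam mu) = verts (K a (Suc p) lam mu) \<inter> {..<p} \<times> {..<a}"
    unfolding verts using sub by blast
  moreover have "ends (K a q lam mu) = fst" for q
    by (simp add: K_def)
  ultimately show ?thesis
    unfolding induced_subgraph_def
    by (intro multigraph.equality) simp_all
qed

end

theory Submission
  imports Defs "HOL-Library.Multiset"
begin

text \<open>Everything is read off from lists of vertices. A family of vertex-disjoint paths covering a
vertex set is a multiset of lists, and a set of edges is compared with it through the multiset
of its end pairs. The lists may be empty, so that conditions (iii) and (iv) together say exactly
that each colour class of $G$ is carried by a family of exactly \<open>a\<close> lists
(\<open>linear_forest_iff_path_system\<close>).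

For necessity, remove the \<open>a\<close> new vertices from a Hamiltonian cycle: it falls into at most \<open>a\<close>
paths (\<open>cut_path\<close>), which is (iii) and (iv); counting the edges at one vertex gives (i). Since
some path is nonempty, each colour has at most \<open>a - 1\<close> edges inside the new part, and (ii)
follows by comparing with the number of all edges there.

For sufficiency, identify all new vertices with a single vertex \<open>w\<close>. Each colour then
consists of \<open>a\<close> petals at \<open>w\<close>: a nonempty list is a path both of whose tips are joined
to \<open>w\<close>, and an empty list is a loop at \<open>w\<close>. The new vertices are split off one at a time.
When \<open>m \<ge> 2\<close> of them are still merged in \<open>w\<close>, two of the \<open>2 * m\<close> edge ends of each colour at
\<open>w\<close> are handed over to the new vertex. They are taken from two different petals, which the new
vertex joins to a single one, so that \<open>m - 1\<close> petals are left and no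
closed component arises. The multiplicities come out right if in addition exactly one \<open>m\<close>-th of the
edge ends belonging to each neighbour of \<open>w\<close>, and of the ends of loops, is handed over.
Both requirements can be met at once because the choice is a perfect matching in an \<open>m\<close>-regular
bipartite multigraph (\<open>balanced_transversal\<close>, \<open>detach_vertex\<close>). The divisibility needed here holds
at every stage, since every vertex on a petal has degree two in each colour, counting its edges to
\<open>w\<close>, and total degree \<open>2 * k\<close> (\<open>count_tips\<close>). When \<open>w\<close> is a single vertex again, each colour has
one petal, which together with \<open>w\<close> is a Hamiltonian cycle.\<close>

section \<open>Vertex lists and the pairs that they link\<close>
fun links :: "'v list \<Rightarrow> 'v set list" where
  "links (x # y # zs) = {x, y} # links (y # zs)"
| "links _ = []"

text \<open>The two ends of a petal; \<open>None\<close> stands for the vertex at which the petals meet, to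
which both ends of a loop (the empty list) belong.\<close>
definition tip :: "nat \<Rightarrow> 'v list \<Rightarrow> 'v option" where
  "tip s P = (if P = [] then None else Some (if s = 0 then hd P else last P))"

definition spoke :: "'v \<Rightarrow> 'v option \<Rightarrow> 'v set multiset" where
  "spoke w t = (case t of None \<Rightarrow> {#} | Some v \<Rightarrow> {#{v, w}#})"

definition deg :: "'v \<Rightarrow> 'v set multiset \<Rightarrow> nat" where
  "deg v L = size (filter_mset (\<lambda>X. v \<in> X) L)"

definition cover :: "'v list multiset \<Rightarrow> 'v multiset" where
  "cover M = (\<Sum>P\<in>#M. mset P)"

definition linkage :: "'v list multiset \<Rightarrow> 'v set multiset" where
  "linkage M = (\<Sum>P\<in>#M. mset (links P))"

definition tips :: "'v list multiset \<Rightarrow> 'v option multiset" where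
  "tips M = (\<Sum>P\<in>#M. {#tip 0 P, tip 1 P#})"

lemma cover_simps [simp]:
  "cover {#} = {#}" "cover (add_mset P M) = mset P + cover M" "cover (M + N) = cover M + cover N"
  by (simp_all add: cover_def)

lemma linkage_simps [simp]:
  "linkage {#} = {#}" "linkage (add_mset P M) = mset (links P) + linkage M"
  "linkage (M + N) = linkage M + linkage N"
  by (simp_all add: linkage_def)

lemma tips_simps [simp]:
  "tips {#} = {#}" "tips (add_mset P M) = {#tip 0 P, tip 1 P#} + tips M"
  by (simp_all add: tips_def)

lemma size_tips: "size (tips M) = 2 * size M"
  by (induction M) simp_all

lemma deg_simps [simp]: "deg v {#} = 0" "deg v (L + L') = deg v L + deg v L'"
  "deg v (add_mset X L) = (if v \<in> X then 1 else 0) + deg v L"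
  by (simp_all add: deg_def)

lemma deg_eq_0: "(\<And>X. X \<in># L \<Longrightarrow> v \<notin> X) \<Longrightarrow> deg v L = 0"
  by (induction L) auto

lemma deg_sum: "deg v (\<Sum>j\<in>J. L j) = (\<Sum>j\<in>J. deg v (L j))"
  by (induction J rule: infinite_finite_induct) simp_all

lemma deg_image_mset_set:
  "finite E \<Longrightarrow> deg v (image_mset f (mset_set E)) = card {e \<in> E. v \<in> f e}"
  by (simp add: deg_def filter_mset_image_mset)

lemma count_image_mset_set:
  "finite E \<Longrightarrow> count (image_mset f (mset_set E)) X = card {e \<in> E. f e = X}"
  by (simp add: count_conv_size_mset filter_mset_image_mset eq_commute)

lemma length_links: "length (links P) = length P - 1"
  by (induction P rule: links.induct) simp_all

lemma nth_links: "Suc i < length P \<Longrightarrow> links P ! i = {P ! i, P ! Suc i}"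
  by (induction P arbitrary: i rule: links.induct) (auto simp: nth_Cons split: nat.split)

lemma in_links_subset: "X \<in> set (links P) \<Longrightarrow> X \<subseteq> set P \<and> X \<noteq> {}"
  by (induction P rule: links.induct) auto

lemma in_links_card: "distinct P \<Longrightarrow> X \<in> set (links P) \<Longrightarrow> card X = 2"
  by (induction P rule: links.induct) auto

text \<open>Both the joining of two petals and the closing of a cycle are instances of this formula.
If one of the two lists is empty, the inserted vertex becomes a tip and that side contributes no link.\<close>
lemma mset_links_insert:
  "mset (links (xs @ w # ys)) =
     mset (links xs) + spoke w (tip 1 xs) + spoke w (tip 0 ys) + mset (links ys)"
proof (induction xs rule: links.induct)
  case "2_1"
  then show ?case
    by (cases ys) (auto simp: spoke_def tip_def insert_commute)
next
  case ("2_2" v)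
  then show ?case
    by (cases ys) (auto simp: spoke_def tip_def insert_commute)
qed (auto simp: tip_def)

lemma links_rev: "mset (links (rev P)) = mset (links P)"
proof (induction P)
  case (Cons x P)
  have "mset (links (rev P @ x # [])) = mset (links ([] @ x # P))"
    unfolding mset_links_insert using Cons by (auto simp: tip_def last_rev)
  then show ?case
    by simp
qed simp

lemma deg_spoke: "v \<noteq> w \<Longrightarrow> deg v (spoke w t) = (if t = Some v then 1 else 0)"
  by (auto simp: spoke_def split: option.split)

text \<open>An inner vertex of a path has two links, a tip only one, and the vertex of a one-element list
is a tip twice. So tips make up for the missing degree.\<close>
lemma deg_links_plus_tips:
  assumes "distinct P"
  shows "deg v (mset (links P)) + count {#tip 0 P, tip 1 P#} (Some v) = 2 * count (mset P) v"
  using assms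
proof (induction P)
  case (Cons x P)
  have links: "mset (links (x # P)) = spoke x (tip 0 P) + mset (links P)"
    using mset_links_insert[of "[]" x P] by (simp add: tip_def spoke_def)
  show ?case
  proof (cases "v = x")
    case True
    with Cons.prems have "v \<notin> set P" by simp
    moreover from this have "deg v (mset (links P)) = 0"
      by (intro deg_eq_0) (auto dest!: in_links_subset)
    ultimately show ?thesis
      using True unfolding links by (auto simp: spoke_def tip_def count_mset_0_iff)
  next
    case False
    then show ?thesis
      using Cons unfolding links by (auto simp: deg_spoke tip_def)
  qed
qed (simp add: tip_def)

lemma deg_linkage_plus_tips:
  assumes "\<And>P. P \<in># M \<Longrightarrow> distinct P"
  shows "deg v (linkage M) + count (tips M) (Some v) = 2 * count (cover M) v"
  using assms
proof (induction M)
  case (add P M)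
  then show ?case
    using deg_links_plus_tips[of P v] by fastforce
qed simp

text \<open>An equation \<open>cover M = mset_set S\<close> carries three facts at once, since all counts on the right
are at most one: the lists have no repetitions, they are pairwise disjoint, and their union is \<open>S\<close>.\<close>
lemma cover_eq_mset_setD:
  assumes "cover M = mset_set S" "P \<in># M"
  shows "distinct P" and "finite S \<Longrightarrow> set P \<subseteq> S"
proof -
  obtain N where M: "M = add_mset P N"
    using assms(2) by (metis multi_member_split)
  have sub: "mset P \<subseteq># mset_set S"
    using assms(1) unfolding M by (metis cover_simps(2) mset_subset_eq_add_left)
  have "count (mset P) x \<le> 1" for x
    by (rule order_trans[OF mset_subset_eq_count[OF sub]]) (simp add: count_mset_set')
  then show "distinct P"
    by (metis count_eq_zero_iff distinct_count_atmost_1 le_antisym less_one not_le set_mset_mset)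
  show "set P \<subseteq> S" if "finite S"
    using set_mset_mono[OF sub] that by simp
qed

lemma in_linkage_iff: "X \<in># linkage M \<longleftrightarrow> (\<exists>P\<in>#M. X \<in> set (links P))"
  by (induction M) auto

lemma in_tips_iff: "t \<in># tips M \<longleftrightarrow> (\<exists>P\<in>#M. t = tip 0 P \<or> t = tip 1 P)"
  by (induction M) auto

lemma in_linkage_coverD:
  assumes "cover M = mset_set S" "finite S" "X \<in># linkage M"
  shows "X \<subseteq> S" and "card X = 2"
  using assms cover_eq_mset_setD[of M S] in_links_subset in_links_card
  unfolding in_linkage_iff by (metis order_trans)+

section \<open>Balanced selection in a regular bipartite multigraph\<close>

text \<open>Rado's argument: as long as some \<open>A i\<close> has two elements \<open>x\<close> and \<open>y\<close>, one of
them can be removed without violating Hall's condition. Otherwise there are index sets \<open>J\<close> and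
\<open>K\<close> witnessing the two violations, and the submodularity of the size of a union, applied to
\<open>J\<close> and \<open>K\<close>, contradicts the condition for \<open>insert i (J \<union> K)\<close> and \<open>J \<inter> K\<close>. When all sets are
singletons, the condition says that they are distinct.\<close>
lemma Hall_marriage:
  fixes A :: "'i \<Rightarrow> 'b set"
  assumes "finite I" and "\<And>i. i \<in> I \<Longrightarrow> finite (A i)"
    and "\<And>J. J \<subseteq> I \<Longrightarrow> card J \<le> card (\<Union>i\<in>J. A i)"
  shows "\<exists>R. inj_on R I \<and> (\<forall>i\<in>I. R i \<in> A i)"
  using assms(2,3)
proof (induction "\<Sum>i\<in>I. card (A i)" arbitrary: A rule: less_induct)
  case less
  show ?case
  proof (cases "\<exists>i\<in>I. \<exists>x\<in>A i. \<exists>y\<in>A i. x \<noteq> y")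
    case False
    have "A i \<noteq> {}" if "i \<in> I" for i
      using less.prems(2)[of "{i}"] that by auto
    then have "\<exists>R. \<forall>i\<in>I. R i \<in> A i"
      by (intro bchoice) blast
    then obtain R where R: "R i \<in> A i" if "i \<in> I" for i
      by blast
    with False have single: "A i = {R i}" if "i \<in> I" for i
      using that by blast
    have "inj_on R I"
    proof (rule inj_onI, rule ccontr)
      fix i j assume ij: "i \<in> I" "j \<in> I" "R i = R j" "i \<noteq> j"
      then have "card {i, j} \<le> card (\<Union>i\<in>{i, j}. A i)"
        using less.prems(2)[of "{i, j}"] by blast
      with ij single show False
        by auto
    qed
    with R show ?thesis by blast
  next
    case True
    then obtain i x y where i: "i \<in> I" and x: "x \<in> A i" and y: "y \<in> A i" and xy: "x \<noteq> y"
      by blast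
    have shrink: "\<exists>R. inj_on R I \<and> (\<forall>i\<in>I. R i \<in> A i)"
      if z: "z \<in> A i"
        and hall: "\<And>J. J \<subseteq> I - {i} \<Longrightarrow> card J < card ((\<Union>j\<in>J. A j) \<union> (A i - {z}))" for z
    proof -
      let ?B = "A(i := A i - {z})"
      have fin: "finite (?B j)" if "j \<in> I" for j
        using less.prems(1) that i by auto
      have "(\<Sum>j\<in>I. card (?B j)) < (\<Sum>j\<in>I. card (A j))"
      proof (rule sum_strict_mono_ex1[OF assms(1)])
        show "\<forall>j\<in>I. card (?B j) \<le> card (A j)"
          using less.prems(1) by (auto intro: card_mono)
        show "\<exists>j\<in>I. card (?B j) < card (A j)"
          using card_Diff1_less[OF less.prems(1)[OF i] z] i by (intro bexI[of _ i]) simp_all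
      qed
      moreover have "card J \<le> card (\<Union>j\<in>J. ?B j)" if J: "J \<subseteq> I" for J
      proof (cases "i \<in> J")
        case False
        then have "(\<Union>j\<in>J. ?B j) = (\<Union>j\<in>J. A j)"
          by auto
        with less.prems(2)[OF J] show ?thesis by simp
      next
        case True
        have "(\<Union>j\<in>J. ?B j) = (\<Union>j\<in>J - {i}. A j) \<union> (A i - {z})"
          using True by auto
        moreover have "card (J - {i}) < card ((\<Union>j\<in>J - {i}. A j) \<union> (A i - {z}))"
          using J by (intro hall) auto
        moreover have "card J = Suc (card (J - {i}))"
          using True J assms(1) by (metis card.remove finite_subset)
        ultimately show ?thesis by simp
      qed
      ultimately obtain R where "inj_on R I" "\<forall>j\<in>I. R j \<in> ?B j"
        using less.hyps[of ?B] fin by blast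
      then show ?thesis
        by (metis Diff_iff fun_upd_apply)
    qed
    show ?thesis
    proof (rule ccontr)
      assume no: "\<not> ?thesis"
      obtain J where J: "J \<subseteq> I - {i}" "card ((\<Union>j\<in>J. A j) \<union> (A i - {x})) \<le> card J"
        using shrink[OF x] no by (meson leI)
      obtain K where K: "K \<subseteq> I - {i}" "card ((\<Union>j\<in>K. A j) \<union> (A i - {y})) \<le> card K"
        using shrink[OF y] no by (meson leI)
      let ?X = "(\<Union>j\<in>J. A j) \<union> (A i - {x})" and ?Y = "(\<Union>j\<in>K. A j) \<union> (A i - {y})"
      have finJK: "finite J" "finite K"
        using J K assms(1) by (auto dest: finite_subset)
      have finXY: "finite ?X" "finite ?Y"
        using J K i finJK less.prems(1) by auto
      have "(\<Union>j\<in>insert i (J \<union> K). A j) \<subseteq> ?X \<union> ?Y"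
        using xy by auto
      then have "card (insert i (J \<union> K)) \<le> card (?X \<union> ?Y)"
        using less.prems(2)[of "insert i (J \<union> K)"] J(1) K(1) i finXY
        by (intro order.trans[OF _ card_mono[of "?X \<union> ?Y"]]) blast+
      moreover have "card (insert i (J \<union> K)) = Suc (card (J \<union> K))"
        using J K finJK by (subst card_insert_disjoint) auto
      moreover have "card (J \<inter> K) \<le> card (?X \<inter> ?Y)"
      proof -
        have "card (J \<inter> K) \<le> card (\<Union>j\<in>J \<inter> K. A j)"
          using J by (intro less.prems(2)) auto
        also have "\<dots> \<le> card (?X \<inter> ?Y)"
          using finXY by (intro card_mono) auto
        finally show ?thesis .
      qed
      ultimately have "card J + card K < card ?X + card ?Y"
        using card_Un_Int[OF finJK] card_Un_Int[OF finXY] by linarith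
      with J K show False by linarith
    qed
  qed
qed

text \<open>The elements of \<open>E\<close> are the edges of a bipartite multigraph between the values of \<open>f\<close> and
those of \<open>g\<close>. Splitting each value \<open>r\<close> of \<open>g\<close> into \<open>d r\<close> vertices of degree \<open>m\<close> makes the
multigraph \<open>m\<close>-regular, and a perfect matching of it is the set \<open>S\<close>.\<close>
lemma balanced_transversal:
  fixes f :: "'e \<Rightarrow> 'l" and g :: "'e \<Rightarrow> 'r"
  assumes "finite E" and "m > 0"
    and f: "\<And>l. l \<in> f ` E \<Longrightarrow> card {e \<in> E. f e = l} = m"
    and g: "\<And>r. card {e \<in> E. g e = r} = m * d r"
  shows "\<exists>S\<subseteq>E. bij_betw f S (f ` E) \<and> (\<forall>r. card {e \<in> S. g e = r} = d r)"
proof -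
  have "\<exists>h. bij_betw h {e \<in> E. g e = r} {..<m * d r}" for r
    using g[of r] assms(1) by (intro finite_same_card_bij) auto
  then obtain h where h: "bij_betw (h r) {e \<in> E. g e = r} {..<m * d r}" for r
    by metis
  (* The value of q says in which of the d r blocks of size m of its fibre the edge lies. *)
  define q where "q e = (g e, h (g e) e div m)" for e
  have q: "card {e \<in> E. q e = (r, i)} = m" if "i < d r" for r i
  proof -
    have "bij_betw (h r) {e \<in> E. q e = (r, i)} {m * i..<m * i + m}"
    proof (rule bij_betw_subset[OF h])
      have range: "{m * i..<m * i + m} \<subseteq> {..<m * d r}"
        using mult_le_mono2[of "Suc i" "d r" m] that by auto
      have div: "x div m = i \<longleftrightarrow> x \<in> {m * i..<m * i + m}" for x
        using div_nat_eqI[of m i x] dividend_less_times_div[OF assms(2), of x] times_div_less_eq_dividend[of m x]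
        by (auto simp: add.commute)
      show "h r ` {e \<in> E. q e = (r, i)} = {m * i..<m * i + m}"
      proof -
        have "h r ` {e \<in> E. q e = (r, i)} = {x \<in> h r ` {e \<in> E. g e = r}. x div m = i}"
          unfolding q_def by auto
        also have "\<dots> = {m * i..<m * i + m}"
          using h[of r] range div unfolding bij_betw_def by auto
        finally show ?thesis .
      qed
    qed (auto simp: q_def)
    then show ?thesis
      by (auto dest: bij_betw_same_card)
  qed
  have q_range: "snd (q e) < d (fst (q e))" if "e \<in> E" for e
  proof -
    have "h (g e) e \<in> {..<m * d (g e)}"
      using bij_betwE[OF h[of "g e"]] that by blast
    then show ?thesis
      by (simp add: q_def less_mult_imp_div_less mult.commute)
  qed
  have q': "card {e \<in> E. q e = s} = m" if "s \<in> q ` E" for s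
    using q[of "snd s" "fst s"] q_range that by auto
  have fibres: "card {e \<in> E. \<phi> e \<in> T} = m * card T"
    if "\<And>s. s \<in> T \<Longrightarrow> card {e \<in> E. \<phi> e = s} = m" "finite T" for \<phi> :: "'e \<Rightarrow> 'x" and T
  proof -
    have "card {e \<in> E. \<phi> e \<in> T} = card (\<Union>s\<in>T. {e \<in> E. \<phi> e = s})"
      by (intro arg_cong[of _ _ card]) auto
    also have "\<dots> = (\<Sum>s\<in>T. card {e \<in> E. \<phi> e = s})"
      using that(2) assms(1) by (intro card_UN_disjoint) auto
    also have "\<dots> = m * card T"
      using that(1) by simp
    finally show ?thesis .
  qed
  have "\<exists>R. inj_on R (f ` E) \<and> (\<forall>l\<in>f ` E. R l \<in> q ` {e \<in> E. f e = l})"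
  proof (rule Hall_marriage)
    fix J assume J: "J \<subseteq> f ` E"
    let ?T = "\<Union>l\<in>J. q ` {e \<in> E. f e = l}"
    have finJ: "finite J" "finite ?T"
      using J assms(1) by (auto dest: finite_subset)
    have "m * card J = card {e \<in> E. f e \<in> J}"
      using fibres[of J f] f subsetD[OF J] finJ(1) by metis
    also have "\<dots> \<le> card {e \<in> E. q e \<in> ?T}"
      using assms(1) by (intro card_mono) auto
    also have "\<dots> = m * card ?T"
      using finJ by (intro fibres q') auto
    finally show "card J \<le> card ?T"
      using assms(2) by simp
  qed (use assms(1) in auto)
  then obtain R where R: "inj_on R (f ` E)" and "\<forall>l\<in>f ` E. R l \<in> q ` {e \<in> E. f e = l}"
    by blast
  then have "\<forall>l\<in>f ` E. \<exists>e. e \<in> E \<and> f e = l \<and> q e = R l"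
    by fastforce
  then have "\<exists>e. \<forall>l\<in>f ` E. e l \<in> E \<and> f (e l) = l \<and> q (e l) = R l"
    by (rule bchoice)
  then obtain e where e: "e l \<in> E" "f (e l) = l" "q (e l) = R l" if "l \<in> f ` E" for l
    by blast
  define S where "S = e ` f ` E"
  have S: "S \<subseteq> E"
    using e by (auto simp: S_def)
  have bij: "bij_betw f S (f ` E)"
    unfolding S_def using e by (auto simp: bij_betw_def inj_on_def image_iff)
  have inj: "inj_on q S"
  proof (rule inj_onI)
    fix x y assume "x \<in> S" "y \<in> S" and xy: "q x = q y"
    then obtain l l' where l: "l \<in> f ` E" "x = e l" "l' \<in> f ` E" "y = e l'"
      unfolding S_def by blast
    with xy e have "R l = R l'"
      by metis
    with R l show "x = y"
      by (metis inj_onD)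
  qed
  have all: "{e \<in> E. \<phi> e \<in> \<phi> ` E} = E" for \<phi> :: "'e \<Rightarrow> 'x"
    by blast
  have "m * card (f ` E) = card E"
    using fibres[of "f ` E" f] f assms(1) unfolding all by simp
  moreover have "m * card (q ` E) = card E"
    using fibres[of "q ` E" q] q' assms(1) unfolding all by simp
  ultimately have "card (q ` S) = card (q ` E)"
    using assms(2) card_image[OF inj] bij_betw_same_card[OF bij]
    by (metis mult_left_cancel not_gr_zero)
  then have onto: "q ` S = q ` E"
    using S assms(1) by (intro card_subset_eq) auto
  have "card {e \<in> S. g e = r} = d r" for r
  proof -
    have "q ` {e \<in> S. g e = r} = Pair r ` {..<d r}"
    proof (intro subset_antisym subsetI)
      fix s assume "s \<in> Pair r ` {..<d r}"
      then obtain i where s: "s = (r, i)" and i: "i < d r" by auto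
      from q[OF i] assms(2) have "(r, i) \<in> q ` E"
        by (metis (mono_tags, lifting) Collect_empty_eq card.empty imageI less_irrefl)
      then obtain e where "e \<in> S" "q e = (r, i)"
        unfolding onto[symmetric] by auto
      then show "s \<in> q ` {e \<in> S. g e = r}"
        unfolding s image_iff by (intro bexI[of _ e]) (auto simp: q_def)
    qed (use S q_range in \<open>force simp: q_def\<close>)
    moreover have "inj_on q {e \<in> S. g e = r}"
      by (rule inj_on_subset[OF inj]) auto
    ultimately have "card {e \<in> S. g e = r} = card (Pair r ` {..<d r})"
      by (metis card_image)
    then show ?thesis
      by (simp add: card_image inj_on_def)
  qed
  with S bij show ?thesis by blast
qed

section \<open>Splitting off one vertex\<close>
lemma tip_rev: "tip (Suc 0) (rev P) = tip 0 P" "tip 0 (rev P) = tip (Suc 0) P"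
  by (simp_all add: tip_def hd_rev last_rev)

text \<open>Reverse the two petals, if necessary, so that the chosen tips become adjacent to the new vertex.\<close>
lemma join_through:
  assumes "x < 2" "y < 2"
  shows "\<exists>R. mset R = add_mset w (mset P + mset Q) \<and>
    mset (links R) = mset (links P) + mset (links Q) + spoke w (tip x P) + spoke w (tip y Q)"
proof -
  have orient: "\<exists>P'. mset P' = mset P \<and> mset (links P') = mset (links P) \<and> tip 1 P' = tip x P"
    if "x < 2" for P :: "'a list" and x
  proof (cases "x = 0")
    case True
    then show ?thesis
      by (intro exI[of _ "rev P"]) (simp add: links_rev tip_rev)
  next
    case False
    with that have "x = 1" by simp
    then show ?thesis by blast
  qed
  obtain P' where P': "mset P' = mset P" "mset (links P') = mset (links P)" "tip 1 P' = tip x P"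
    using orient[OF assms(1)] by blast
  obtain Q' where Q': "mset Q' = mset Q" "mset (links Q') = mset (links Q)" "tip 1 Q' = tip y Q"
    using orient[OF assms(2)] by blast
  show ?thesis
    unfolding mset_links_insert
    by (intro exI[of _ "P' @ w # rev Q'"])
      (simp add: mset_links_insert P' Q' links_rev tip_rev P'[unfolded One_nat_def] Q'[unfolded One_nat_def])
qed

lemma count_tips_mset:
  "count (tips (mset xs)) t = (\<Sum>i<length xs. card {x \<in> {..<2}. tip x (xs ! i) = t})"
proof (induction xs)
  case (Cons P xs)
  have "{x \<in> {..<2}. tip x P = t} = (if tip 0 P = t then {0} else {}) \<union> (if tip 1 P = t then {1} else {})"
    by (auto simp: less_2_cases_iff intro: gr0I)
  then have "card {x \<in> {..<2}. tip x P = t} = count {#tip 0 P, tip 1 P#} t"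
    by auto
  then show ?case
    using Cons by (simp add: sum.lessThan_Suc_shift del: sum.lessThan_Suc)
qed simp

lemma mset_split_two:
  assumes "i < length xs" "j < length xs" "i \<noteq> j"
  shows "\<exists>R. mset xs = {#xs ! i, xs ! j#} + R"
proof -
  have "{i, j} \<subseteq> {..<length xs}"
    using assms by auto
  then have "mset_set {..<length xs} = mset_set {i, j} + mset_set ({..<length xs} - {i, j})"
    by (subst mset_set_Union[symmetric]) (auto intro!: arg_cong[of _ _ mset_set])
  moreover have "mset xs = image_mset (nth xs) (mset_set {..<length xs})"
    by (metis map_nth mset_map mset_upt atLeast_upt atLeast0LessThan)
  ultimately show ?thesis
    using assms(3) by auto
qed

text \<open>The new vertex \<open>w\<close> takes over two edge ends of each colour, from different petals, such that \<open>d t\<close> of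
all chosen ends belong to the neighbour \<open>t\<close>. To force exactly two of the \<open>m\<close> petals of a colour to
be chosen, each petal gets, besides its tips, which are numbered 0 and 1, dummy ends numbered
\<open>2, \<dots>, m - 1\<close>. All petals of a colour share the dummies: the dummy of number \<open>x\<close> in colour \<open>j\<close>
is a single vertex, of degree \<open>m\<close>. In the resulting \<open>m\<close>-regular multigraph a perfect matching
matches exactly \<open>m - 2\<close> petals of each colour with dummies. The multiset \<open>B j\<close> consists of the
tips chosen in colour \<open>j\<close>.\<close>
lemma detach_vertex:
  fixes M :: "'c \<Rightarrow> 'v list multiset"
  assumes J: "finite J" and m: "m \<ge> 2"
    and size: "\<And>j. j \<in> J \<Longrightarrow> size (M j) = m"
    and tips: "\<And>t. count (\<Sum>j\<in>J. tips (M j)) t = m * d t"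
  obtains M' B where
    "\<And>j. j \<in> J \<Longrightarrow> size (M' j) = m - 1"
    "\<And>j. j \<in> J \<Longrightarrow> cover (M' j) = add_mset w (cover (M j))"
    "\<And>j. j \<in> J \<Longrightarrow> linkage (M' j) = linkage (M j) + (\<Sum>t\<in>#B j. spoke w t)"
    "\<And>t. count (\<Sum>j\<in>J. B j) t = d t"
proof -
  have "\<exists>Q. \<forall>j. mset (Q j) = M j"
    by (intro choice allI ex_mset)
  then obtain Q where Q: "\<And>j. mset (Q j) = M j"
    by blast
  have len: "length (Q j) = m" if "j \<in> J" for j
    using size[OF that] Q[of j] by (metis size_mset)
  define E where "E = J \<times> {..<m} \<times> {..<m}"
  define f :: "'c \<times> nat \<times> nat \<Rightarrow> 'c \<times> nat" where "f = (\<lambda>(j, i, x). (j, i))"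
  define g :: "'c \<times> nat \<times> nat \<Rightarrow> 'v option + 'c \<times> nat"
    where "g = (\<lambda>(j, i, x). if x < 2 then Inl (tip x (Q j ! i)) else Inr (j, x))"
  define d' where "d' = (\<lambda>r. case r of Inl t \<Rightarrow> d t | Inr (j, x) \<Rightarrow> if j \<in> J \<and> 2 \<le> x \<and> x < m then 1 else 0)"
  have fE: "f ` E = J \<times> {..<m}"
    using m by (force simp: f_def E_def)
  have "\<exists>S\<subseteq>E. bij_betw f S (f ` E) \<and> (\<forall>r. card {e \<in> S. g e = r} = d' r)"
  proof (rule balanced_transversal)
    fix l assume "l \<in> f ` E"
    then have "{e \<in> E. f e = l} = (\<lambda>x. (fst l, snd l, x)) ` {..<m}"
      unfolding fE by (auto simp: E_def f_def)
    then show "card {e \<in> E. f e = l} = m"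
      by (simp add: card_image inj_on_def)
  next
    fix r
    show "card {e \<in> E. g e = r} = m * d' r"
    proof (cases r)
      case (Inl t)
      have "{e \<in> E. g e = r} = (SIGMA j:J. SIGMA i:{..<m}. {x \<in> {..<2}. tip x (Q j ! i) = t})"
        using m by (auto simp: E_def g_def Inl split: if_splits)
      then have "card {e \<in> E. g e = r} = (\<Sum>j\<in>J. \<Sum>i<m. card {x \<in> {..<2}. tip x (Q j ! i) = t})"
        using J by simp
      also have "\<dots> = (\<Sum>j\<in>J. count (tips (M j)) t)"
        by (intro sum.cong refl) (simp add: count_tips_mset len flip: Q)
      also have "\<dots> = m * d t"
        using tips[of t] by (simp add: count_sum)
      finally show ?thesis
        by (simp add: Inl d'_def)
    next
      case (Inr p)
      obtain j x where p: "p = (j, x)" by (cases p)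
      have "{e \<in> E. g e = r} =
          (if j \<in> J \<and> 2 \<le> x \<and> x < m then (\<lambda>i. (j, i, x)) ` {..<m} else {})"
        by (auto simp: E_def g_def Inr p split: if_splits)
      then show ?thesis
        by (simp add: Inr p d'_def card_image inj_on_def)
    qed
  qed (use J m in \<open>auto simp: E_def\<close>)
  then obtain S where S: "S \<subseteq> E" "bij_betw f S (J \<times> {..<m})"
      and card_S: "\<And>r. card {e \<in> S. g e = r} = d' r"
    unfolding fE by blast
  have "\<exists>!x. (j, i, x) \<in> S" if "j \<in> J" "i < m" for j i
  proof -
    have "(j, i) \<in> f ` S"
      using S(2) that by (auto simp: bij_betw_def)
    moreover have "x = y" if "(j, i, x) \<in> S" "(j, i, y) \<in> S" for x y
      using inj_onD[OF bij_betw_imp_inj_on[OF S(2)] _ that] by (simp add: f_def)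
    ultimately show ?thesis
      by (auto simp: f_def)
  qed
  then obtain s where s: "\<And>j i x. j \<in> J \<Longrightarrow> i < m \<Longrightarrow> (j, i, x) \<in> S \<longleftrightarrow> x = s j i"
    by metis
  have s_less: "s j i < m" if "j \<in> J" "i < m" for j i
    using s[OF that, of "s j i"] S(1) by (auto simp: E_def)
  have fibre: "{e \<in> S. g e = r} = (\<lambda>(j, i). (j, i, s j i)) ` (SIGMA j:J. {i \<in> {..<m}. g (j, i, s j i) = r})" for r
    using S(1) s by (force simp: E_def image_iff)
  have card_s: "(\<Sum>j\<in>J. card {i \<in> {..<m}. g (j, i, s j i) = r}) = d' r" for r
    unfolding card_S[symmetric] fibre using J
    by (subst card_image) (auto simp: inj_on_def)
  define I where "I j = {i \<in> {..<m}. s j i < 2}" for j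
  (* Each of the m - 2 dummies of colour j is matched with exactly one petal. *)
  have card_I: "card (I j) = 2" if j: "j \<in> J" for j
  proof -
    have one: "card {i \<in> {..<m}. s j i = x} = 1" if x: "x \<in> {2..<m}" for x
    proof -
      have "card {i \<in> {..<m}. g (j', i, s j' i) = Inr (j, x)} =
          (if j' = j then card {i \<in> {..<m}. s j i = x} else 0)" for j'
        using x by (auto simp: g_def intro!: arg_cong[of _ _ card] split: if_splits)
      then show ?thesis
        using card_s[of "Inr (j, x)"] J j x by (simp add: d'_def)
    qed
    have "{..<m} = I j \<union> (\<Union>x\<in>{2..<m}. {i \<in> {..<m}. s j i = x})"
      using s_less[OF j] by (auto simp: I_def)
    then have "card {..<m} = card (I j \<union> (\<Union>x\<in>{2..<m}. {i \<in> {..<m}. s j i = x}))"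
      by (rule arg_cong)
    also have "\<dots> = card (I j) + card (\<Union>x\<in>{2..<m}. {i \<in> {..<m}. s j i = x})"
      by (intro card_Un_disjoint) (auto simp: I_def)
    also have "card (\<Union>x\<in>{2..<m}. {i \<in> {..<m}. s j i = x}) = (\<Sum>x\<in>{2..<m}. card {i \<in> {..<m}. s j i = x})"
      by (intro card_UN_disjoint) auto
    also have "\<dots> = m - 2"
      using one by simp
    finally show ?thesis using m by simp
  qed
  define B where "B j = image_mset (\<lambda>i. tip (s j i) (Q j ! i)) (mset_set (I j))" for j
  have "\<exists>N. size N = m - 1 \<and> cover N = add_mset w (cover (M j)) \<and>
      linkage N = linkage (M j) + (\<Sum>t\<in>#B j. spoke w t)" if j: "j \<in> J" for j
  proof -
    obtain i i' where I: "I j = {i, i'}" "i \<noteq> i'"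
      using card_I[OF j] by (auto simp: card_2_iff)
    then have i: "i < m" "i' < m" "s j i < 2" "s j i' < 2"
      by (auto simp: I_def)
    obtain R where R: "M j = {#Q j ! i, Q j ! i'#} + R"
      using mset_split_two[of i "Q j" i'] i I(2) len[OF j] unfolding Q by auto
    obtain P where P: "mset P = add_mset w (mset (Q j ! i) + mset (Q j ! i'))"
      "mset (links P) = mset (links (Q j ! i)) + mset (links (Q j ! i')) +
         spoke w (tip (s j i) (Q j ! i)) + spoke w (tip (s j i') (Q j ! i'))"
      using join_through[OF i(3,4), of w "Q j ! i" "Q j ! i'"] by blast
    show ?thesis
      using size[OF j] P I(2)
      by (intro exI[of _ "add_mset P R"]) (simp add: R B_def I(1) ac_simps)
  qed
  then have "\<exists>M'. \<forall>j\<in>J. size (M' j) = m - 1 \<and> cover (M' j) = add_mset w (cover (M j)) \<and>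
      linkage (M' j) = linkage (M j) + (\<Sum>t\<in>#B j. spoke w t)"
    by (intro bchoice) blast
  moreover have "count (\<Sum>j\<in>J. B j) t = d t" for t
  proof -
    have "count (B j) t = card {i \<in> {..<m}. g (j, i, s j i) = Inl t}" for j
      unfolding B_def by (subst count_image_mset_set)
        (auto simp: I_def g_def intro!: arg_cong[of _ _ card] split: if_splits)
    then show ?thesis
      using card_s[of "Inl t"] by (simp add: count_sum d'_def)
  qed
  ultimately show ?thesis
    using that by blast
qed

section \<open>Paths, cycles and components in terms of vertex lists\<close>

text \<open>Every vertex of \<open>W\<close> on the path is a cut. Neighbouring cuts leave an empty list between them,
which makes the number of pieces exact.\<close>
lemma cut_path:
  assumes "distinct P"
  shows "\<exists>M. size M = Suc (card (set P \<inter> W)) \<and> cover M = filter_mset (\<lambda>x. x \<notin> W) (mset P) \<and>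
    linkage M = filter_mset (\<lambda>X. X \<inter> W = {}) (mset (links P))"
  using assms
proof (induction "length P" arbitrary: P rule: less_induct)
  case less
  show ?case
  proof (cases "set P \<inter> W = {}")
    case True
    then have "filter_mset (\<lambda>x. x \<notin> W) (mset P) = mset P"
        "filter_mset (\<lambda>X. X \<inter> W = {}) (mset (links P)) = mset (links P)"
      by (auto simp: filter_mset_eq_conv dest!: in_links_subset)
    with True show ?thesis
      by (intro exI[of _ "{#P#}"]) simp
  next
    case False
    then obtain ys w zs where P: "P = ys @ w # zs" and w: "w \<in> W" and ys: "\<forall>y\<in>set ys. y \<notin> W"
      using split_list_first_prop[of P "\<lambda>x. x \<in> W"] by blast
    obtain M where M: "size M = Suc (card (set zs \<inter> W))" "cover M = filter_mset (\<lambda>x. x \<notin> W) (mset zs)"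
        "linkage M = filter_mset (\<lambda>X. X \<inter> W = {}) (mset (links zs))"
      using less.hyps[of zs] less.prems unfolding P by auto
    have "filter_mset (\<lambda>x. x \<notin> W) (mset ys) = mset ys"
        "filter_mset (\<lambda>X. X \<inter> W = {}) (mset (links ys)) = mset (links ys)"
        "filter_mset (\<lambda>X. X \<inter> W = {}) (spoke w t) = {#}" for t
      using ys w by (auto simp: filter_mset_eq_conv spoke_def split: option.split dest!: in_links_subset)
    moreover have "set P \<inter> W = insert w (set zs \<inter> W)" "w \<notin> set zs \<inter> W"
      using less.prems ys w unfolding P by auto
    ultimately show ?thesis
      using M w by (intro exI[of _ "add_mset ys M"]) (simp add: P mset_links_insert)
  qed
qed

lemma mset_set_eq_plusD:
  assumes "finite E" "mset_set E = B + C"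
  shows "\<exists>D\<subseteq>E. B = mset_set D \<and> C = mset_set (E - D)"
proof -
  have sub: "B \<subseteq># mset_set E"
    using assms(2) by simp
  then have "mset_set (set_mset B) \<subseteq># B" "set_mset B \<subseteq> E"
    using set_mset_mono[OF sub] assms(1) by (auto simp: mset_set_set_mset_msubset)
  moreover have "B \<subseteq># mset_set (set_mset B)"
  proof (rule mset_subset_eqI)
    fix x
    have "count B x \<le> count (mset_set E) x"
      using sub by (rule mset_subset_eq_count)
    also have "\<dots> \<le> 1"
      by (simp add: count_mset_set')
    finally show "count B x \<le> count (mset_set (set_mset B)) x"
      by (cases "x \<in># B") (simp_all add: not_in_iff)
  qed
  ultimately have "B = mset_set (set_mset B)" "set_mset B \<subseteq> E"
    by (simp_all add: subset_mset.antisym)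
  moreover from this have "C = mset_set (E - set_mset B)"
    using assms by (metis add_implies_diff mset_set_Diff add.commute)
  ultimately show ?thesis by blast
qed

text \<open>A prescription of end pairs for every colour that uses each pair as often as there
are edges with these ends is realised by a colouring of the edges.\<close>
lemma split_colours:
  assumes "finite J" "finite E" "(\<Sum>j\<in>J. L j) = image_mset f (mset_set E)"
  shows "\<exists>c. (\<forall>e\<in>E. c e \<in> J) \<and>
    (\<forall>j\<in>J. image_mset f (mset_set {e \<in> E. c e = j}) = L j)"
  using assms
proof (induction J arbitrary: E rule: finite_induct)
  case empty
  then show ?case by (auto simp: mset_set_empty_iff)
next
  case (insert i J)
  then have "image_mset f (mset_set E) = L i + (\<Sum>j\<in>J. L j)"
    by simp
  then obtain B C where "mset_set E = B + C" and L: "L i = image_mset f B"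
      "(\<Sum>j\<in>J. L j) = image_mset f C"
    using image_mset_eq_plusD by metis
  with mset_set_eq_plusD insert.prems(1)
  obtain D where D: "D \<subseteq> E" "B = mset_set D" "C = mset_set (E - D)"
    by metis
  then obtain c where c: "\<forall>e\<in>E - D. c e \<in> J"
      "\<forall>j\<in>J. image_mset f (mset_set {e \<in> E - D. c e = j}) = L j"
    using insert.IH[of "E - D"] insert.prems(1) L by auto
  let ?c = "\<lambda>e. if e \<in> D then i else c e"
  have "{e \<in> E. ?c e = i} = D"
    using D c insert.hyps by auto
  moreover have "{e \<in> E. ?c e = j} = {e \<in> E - D. c e = j}" if "j \<in> J" for j
    using D insert.hyps that by auto
  ultimately show ?case
    using c L D by (intro exI[of _ ?c]) auto
qed


lemma image_mset_eq_msetD: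
  "image_mset f A = mset xs \<Longrightarrow> \<exists>ys. mset ys = A \<and> map f ys = xs"
proof (induction xs arbitrary: A)
  case (Cons x xs)
  then have "image_mset f A = add_mset x (mset xs)"
    by simp
  then obtain N y where A: "A = add_mset y N" "f y = x" "image_mset f N = mset xs"
    by (blast dest: msed_map_invR)
  with Cons.IH obtain ys where "mset ys = N" "map f ys = xs"
    by blast
  with A show ?case
    by (intro exI[of _ "y # ys"]) simp
qed simp

lemma image_mset_set_eq_mset_iff:
  assumes "finite E"
  shows "image_mset f (mset_set E) = mset xs \<longleftrightarrow> (\<exists>es. distinct es \<and> set es = E \<and> map f es = xs)"
proof
  assume "image_mset f (mset_set E) = mset xs"
  then obtain es where es: "mset es = mset_set E" "map f es = xs"
    by (blast dest: image_mset_eq_msetD)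
  then have "distinct es"
    using cover_eq_mset_setD(1)[of "{#es#}" E es] by simp
  moreover have "set es = E"
    using es(1) assms by (metis finite_set_mset_mset_set set_mset_mset)
  ultimately show "\<exists>es. distinct es \<and> set es = E \<and> map f es = xs"
    using es(2) by blast
next
  assume "\<exists>es. distinct es \<and> set es = E \<and> map f es = xs"
  then show "image_mset f (mset_set E) = mset xs"
    by (metis mset_map mset_set_set)
qed

lemma map_eq_iff_nth:
  "map f es = xs \<longleftrightarrow> length xs = length es \<and> (\<forall>i<length es. f (es ! i) = xs ! i)"
  by (auto simp: list_eq_iff_nth_eq)

text \<open>The edges of a multigraph are distinguishable, but whether it is a path or a cycle
depends on the multiset of end pairs only, since the listing of the edges can be recovered.\<close>
abbreviation end_pairs :: "('v, 'e) multigraph \<Rightarrow> 'v set multiset" where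
  "end_pairs H \<equiv> image_mset (ends H) (mset_set (edges H))"

lemma is_path_iff:
  fixes H :: "('v, 'e) multigraph"
  assumes "finite (edges H)"
  shows "is_path H \<longleftrightarrow>
    (\<exists>vs. vs \<noteq> [] \<and> distinct vs \<and> verts H = set vs \<and> end_pairs H = mset (links vs))"
proof -
  have "(length vs = Suc (length es) \<and> (\<forall>i<length es. ends H (es ! i) = {vs ! i, vs ! Suc i}))
      \<longleftrightarrow> (vs \<noteq> [] \<and> map (ends H) es = links vs)" for vs :: "'v list" and es
    unfolding map_eq_iff_nth length_links by (cases vs) (auto simp: nth_links)
  then show ?thesis
    unfolding is_path_def image_mset_set_eq_mset_iff[OF assms] by metis
qed

definition cycle_links :: "'v list \<Rightarrow> 'v set list" where
  "cycle_links vs = links (vs @ [hd vs])"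

lemma is_cycle_iff:
  fixes H :: "('v, 'e) multigraph"
  assumes "finite (edges H)"
  shows "is_cycle H \<longleftrightarrow>
    (\<exists>vs. 2 \<le> length vs \<and> distinct vs \<and> verts H = set vs \<and> end_pairs H = mset (cycle_links vs))"
proof -
  have nth: "cycle_links vs ! i = {vs ! i, vs ! (Suc i mod length vs)}" if "i < length vs"
    for vs :: "'v list" and i
  proof (cases "Suc i = length vs")
    case True
    moreover have "vs \<noteq> []"
      using that by auto
    ultimately show ?thesis
      unfolding cycle_links_def by (subst nth_links) (auto simp: nth_append hd_conv_nth)
  next
    case False
    with that show ?thesis
      unfolding cycle_links_def by (subst nth_links) (auto simp: nth_append)
  qed
  have "(length vs = length es \<and> 2 \<le> length es
        \<and> (\<forall>i<length es. ends H (es ! i) = {vs ! i, vs ! (Suc i mod length es)}))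
      \<longleftrightarrow> (2 \<le> length vs \<and> map (ends H) es = cycle_links vs)" for vs :: "'v list" and es
    unfolding map_eq_iff_nth using nth[of _ vs]
    by (auto simp: cycle_links_def length_links)
  then show ?thesis
    unfolding is_cycle_def image_mset_set_eq_mset_iff[OF assms] by metis
qed

lemma mset_set_UN_disjoint:
  assumes "finite I" "\<And>i. i \<in> I \<Longrightarrow> finite (A i)"
    "\<And>i j. i \<in> I \<Longrightarrow> j \<in> I \<Longrightarrow> i \<noteq> j \<Longrightarrow> A i \<inter> A j = {}"
  shows "mset_set (\<Union>i\<in>I. A i) = (\<Sum>i\<in>I. mset_set (A i))"
  using assms
proof (induction I rule: finite_induct)
  case (insert i I)
  have "A i \<inter> (\<Union>j\<in>I. A j) = {}"
    using insert by blast
  then show ?case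
    using insert by (simp add: mset_set_Union)
qed simp

definition adjacency :: "('v, 'e) multigraph \<Rightarrow> ('v \<times> 'v) set" where
  "adjacency H = {(x, y). \<exists>e\<in>edges H. ends H e = {x, y}}"

lemma sym_adjacency: "sym (adjacency H)"
  by (auto simp: sym_def adjacency_def insert_commute)

lemma connected_in_altdef:
  "connected_in H = (adjacency H)\<^sup>* \<inter> verts H \<times> verts H"
  by (auto simp: connected_in_def adjacency_def)

lemma equiv_connected_in: "equiv (verts H) (connected_in H)"
  unfolding connected_in_altdef
proof (rule equivI)
  show "sym ((adjacency H)\<^sup>* \<inter> verts H \<times> verts H)"
    using sym_rtrancl[OF sym_adjacency, of H] by (auto simp: sym_def)
  show "trans ((adjacency H)\<^sup>* \<inter> verts H \<times> verts H)"
    by (auto simp: trans_def)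
qed (auto simp: refl_on_def)

lemma links_connected:
  assumes "\<And>X. X \<in> set (links P) \<Longrightarrow> X \<in> ends H ` edges H" "x \<in> set P"
  shows "(hd P, x) \<in> (adjacency H)\<^sup>*"
  using assms
proof (induction P rule: links.induct)
  case (1 y z zs)
  have "(y, z) \<in> adjacency H"
    using 1(2)[of "{y, z}"] by (auto simp: adjacency_def)
  moreover have "(z, x) \<in> (adjacency H)\<^sup>*" if "x \<noteq> y"
    using 1 that by auto
  ultimately show ?case
    by (auto intro: converse_rtrancl_into_rtrancl)
qed auto

lemma component_class:
  assumes "loopless_multigraph H" "C \<in> verts H // connected_in H" "e \<in> edges H"
    "v \<in> ends H e" "v \<in> C"
  shows "ends H e \<subseteq> C"
proof
  fix u assume u: "u \<in> ends H e"
  have "card (ends H e) = 2" "ends H e \<subseteq> verts H"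
    using assms unfolding loopless_multigraph_def by auto
  with u assms(4) have "u = v \<or> ends H e = {v, u}" "u \<in> verts H" "v \<in> verts H"
    by (auto simp: card_2_iff)
  then have "(v, u) \<in> connected_in H"
    using assms(3) unfolding connected_in_altdef adjacency_def by blast
  then show "u \<in> C"
    using assms(2,5) in_quotient_imp_closed[OF equiv_connected_in] by metis
qed

text \<open>A bound on the number of paths is turned into an equation by adding empty lists. This is the form
in which the conditions on the components enter the splitting procedure, and
the form in which cutting a Hamiltonian cycle yields them.\<close>
lemma linear_forest_iff_path_system:
  assumes H: "loopless_multigraph H"
  shows "(\<forall>D\<in>components H. is_path D) \<and> num_components H \<le> a \<longleftrightarrow>
    (\<exists>M. size M = a \<and> cover M = mset_set (verts H) \<and> linkage M = end_pairs H)"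
    (is "?L \<longleftrightarrow> ?R")
proof
  have fin: "finite (verts H)" "finite (edges H)"
    using H unfolding loopless_multigraph_def by auto
  have ends: "ends H e \<subseteq> verts H" "card (ends H e) = 2" if "e \<in> edges H" for e
    using H that unfolding loopless_multigraph_def by auto
  let ?Q = "verts H // connected_in H"
  let ?E = "\<lambda>C. {e \<in> edges H. ends H e \<subseteq> C}"
  assume L: ?L
  have finQ: "finite ?Q"
    using fin(1) by (rule finite_quotient) (auto simp: connected_in_altdef)
  have sub: "C \<subseteq> verts H" if "C \<in> ?Q" for C
    using in_quotient_imp_subset[OF equiv_connected_in that] .
  have disj: "C \<inter> C' = {}" if "C \<in> ?Q" "C' \<in> ?Q" "C \<noteq> C'" for C C'
    using quotient_disj[OF equiv_connected_in that(1,2)] that(3) by blast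
  have "inj_on (induced_subgraph H) ?Q"
  proof (rule inj_onI)
    fix C C' assume "C \<in> ?Q" "C' \<in> ?Q" "induced_subgraph H C = induced_subgraph H C'"
    then have "verts H \<inter> C = verts H \<inter> C'"
      by (simp add: induced_subgraph_def)
    with sub \<open>C \<in> ?Q\<close> \<open>C' \<in> ?Q\<close> show "C = C'" by blast
  qed
  then have card: "card ?Q \<le> a"
    using L by (simp add: num_components_def components_def card_image)
  have "\<exists>vs. distinct vs \<and> set vs = C \<and> mset (links vs) = image_mset (ends H) (mset_set (?E C))"
    if C: "C \<in> ?Q" for C
  proof -
    have "is_path (induced_subgraph H C)"
      using L C by (auto simp: components_def)
    moreover have "verts H \<inter> C = C"
      using sub[OF C] by blast
    ultimately show ?thesis
      using fin(2) by (subst (asm) is_path_iff) (auto simp: induced_subgraph_def)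
  qed
  then have "\<exists>vs. \<forall>C\<in>?Q. distinct (vs C) \<and> set (vs C) = C \<and>
      mset (links (vs C)) = image_mset (ends H) (mset_set (?E C))"
    by (intro bchoice) blast
  then obtain vs where vs: "distinct (vs C)" "set (vs C) = C"
      "mset (links (vs C)) = image_mset (ends H) (mset_set (?E C))" if "C \<in> ?Q" for C
    by blast
  let ?M = "image_mset vs (mset_set ?Q) + replicate_mset (a - card ?Q) []"
  have empties: "cover (replicate_mset n []) = {#}" "linkage (replicate_mset n []) = {#}" for n
    by (induction n) simp_all
  have "size ?M = a"
    using card by simp
  moreover have "cover ?M = mset_set (verts H)"
  proof -
    have "cover ?M = (\<Sum>C\<in>?Q. mset (vs C))"
      by (simp add: empties) (simp add: cover_def sum_unfold_sum_mset image_mset.compositionality o_def)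
    also have "\<dots> = (\<Sum>C\<in>?Q. mset_set C)"
      using vs by (intro sum.cong) (auto simp flip: mset_set_set)
    also have "\<dots> = mset_set (\<Union>C\<in>?Q. C)"
      using finQ disj sub fin(1) by (intro mset_set_UN_disjoint[symmetric]) (auto intro: finite_subset[OF sub])
    also have "(\<Union>C\<in>?Q. C) = verts H"
      using Union_quotient[OF equiv_connected_in] by simp
    finally show ?thesis .
  qed
  moreover have "linkage ?M = end_pairs H"
  proof -
    have "linkage ?M = (\<Sum>C\<in>?Q. mset (links (vs C)))"
      by (simp add: empties) (simp add: linkage_def sum_unfold_sum_mset image_mset.compositionality o_def)
    also have "\<dots> = (\<Sum>C\<in>?Q. image_mset (ends H) (mset_set (?E C)))"
      using vs by (intro sum.cong) auto
    also have "\<dots> = image_mset (ends H) (\<Sum>C\<in>?Q. mset_set (?E C))"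
      by (induction rule: infinite_finite_induct) simp_all
    also have "(\<Sum>C\<in>?Q. mset_set (?E C)) = mset_set (\<Union>C\<in>?Q. ?E C)"
    proof (rule mset_set_UN_disjoint[symmetric])
      fix C C' assume "C \<in> ?Q" "C' \<in> ?Q" "C \<noteq> C'"
      then have "C \<inter> C' = {}" by (rule disj)
      moreover have "ends H e \<noteq> {}" if "e \<in> edges H" for e
        using ends(2)[OF that] by auto
      ultimately show "?E C \<inter> ?E C' = {}"
        by blast
    qed (use finQ fin in auto)
    also have "(\<Union>C\<in>?Q. ?E C) = edges H"
    proof -
      have "\<exists>C\<in>?Q. ends H e \<subseteq> C" if e: "e \<in> edges H" for e
      proof -
        obtain v where v: "v \<in> ends H e" "v \<in> verts H"
          using ends[OF e] by (metis card.empty ex_in_conv subsetD zero_neq_numeral)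
        then obtain C where "C \<in> ?Q" "v \<in> C"
          using Union_quotient[OF equiv_connected_in, of H] by blast
        then show ?thesis
          using component_class[OF H _ e v(1)] by blast
      qed
      then show ?thesis by blast
    qed
    finally show ?thesis .
  qed
  ultimately show ?R by blast
next
  assume ?R
  then obtain M where M: "size M = a" "cover M = mset_set (verts H)" "linkage M = end_pairs H"
    by blast
  have fin: "finite (verts H)" "finite (edges H)"
    using H unfolding loopless_multigraph_def by auto
  have P: "distinct P" "set P \<subseteq> verts H" if "P \<in># M" for P
    using cover_eq_mset_setD[OF M(2) that] fin by auto
  have disj: "set P \<inter> set P' = {}" if M_P: "M = add_mset P N" and P': "P' \<in># N" for P P' N
  proof (rule ccontr)
    obtain N' where N: "N = add_mset P' N'"
      using P' by (metis multi_member_split)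
    assume "set P \<inter> set P' \<noteq> {}"
    then obtain x where "x \<in> set P" "x \<in> set P'" by blast
    then have "count (mset P) x \<ge> 1" "count (mset P') x \<ge> 1"
      unfolding One_nat_def Suc_le_eq count_greater_zero_iff by simp_all
    then have "2 \<le> count (cover M) x"
      unfolding M_P N cover_simps count_union by linarith
    also have "\<dots> \<le> 1"
      unfolding M(2) by (simp add: count_mset_set')
    finally show False by simp
  qed
  have X: "card X = 2" if "X \<in># linkage M" for X
    using in_linkage_coverD(2)[OF M(2) fin(1) that] .
  have induced: "image_mset (ends H) (mset_set {e \<in> edges H. ends H e \<subseteq> set P}) = mset (links P)"
    if P_M: "P \<in># M" for P
  proof -
    obtain N where M_P: "M = add_mset P N"
      using P_M by (blast dest: multi_member_split)
    have "image_mset (ends H) (mset_set {e \<in> edges H. ends H e \<subseteq> set P}) =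
        filter_mset (\<lambda>X. X \<subseteq> set P) (linkage M)"
      using fin(2) by (simp add: M(3) filter_mset_image_mset)
    also have "\<dots> = filter_mset (\<lambda>X. X \<subseteq> set P) (mset (links P)) +
        filter_mset (\<lambda>X. X \<subseteq> set P) (linkage N)"
      by (simp add: M_P)
    also have "filter_mset (\<lambda>X. X \<subseteq> set P) (mset (links P)) = mset (links P)"
      by (auto simp: filter_mset_eq_conv dest: in_links_subset)
    also have "filter_mset (\<lambda>X. X \<subseteq> set P) (linkage N) = {#}"
    proof -
      have "\<not> X \<subseteq> set P" if X: "X \<in># linkage N" for X
      proof -
        obtain P' where P': "P' \<in># N" "X \<in> set (links P')"
          using X unfolding in_linkage_iff by blast
        then show ?thesis
          using in_links_subset[OF P'(2)] disj[OF M_P P'(1)] by blast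
      qed
      then show ?thesis
        by (auto simp: filter_mset_eq_conv)
    qed
    finally show ?thesis by simp
  qed
  have conn: "(u, v) \<in> connected_in H" if P_M: "P \<in># M" and u: "u \<in> set P" and v: "v \<in> set P" for P u v
  proof -
    have "X \<in> ends H ` edges H" if "X \<in> set (links P)" for X
    proof -
      have "X \<in># end_pairs H"
        using that P_M unfolding M(3)[symmetric] in_linkage_iff by blast
      then show ?thesis using fin(2) by simp
    qed
    then have "(hd P, x) \<in> (adjacency H)\<^sup>*" if "x \<in> set P" for x
      using links_connected that by metis
    then have "(u, hd P) \<in> (adjacency H)\<^sup>*" "(hd P, v) \<in> (adjacency H)\<^sup>*"
      using u v sym_rtrancl[OF sym_adjacency, of H] by (auto simp: sym_def)
    then show ?thesis
      using u v P(2)[OF P_M] unfolding connected_in_altdef by auto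
  qed
  have closed: "v \<in> set P" if P_M: "P \<in># M" and u: "u \<in> set P" and uv: "(u, v) \<in> (adjacency H)\<^sup>*" for P u v
    using uv
  proof induction
    case (step y z)
    obtain e where e: "e \<in> edges H" "ends H e = {y, z}"
      using step(2) by (auto simp: adjacency_def)
    then have "{y, z} \<in># linkage M"
      unfolding M(3) using fin(2) by (auto intro!: image_eqI[of _ _ e])
    then obtain P' where P': "P' \<in># M" "{y, z} \<subseteq> set P'"
      unfolding in_linkage_iff using in_links_subset by blast
    obtain N where N: "M = add_mset P N"
      using P_M by (blast dest: multi_member_split)
    have "P' = P"
    proof (rule ccontr)
      assume "P' \<noteq> P"
      with P'(1) have "P' \<in># N"
        unfolding N by simp
      with disj[OF N] P'(2) step(3) show False by blast
    qed
    with P' show ?case by simp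
  qed (rule u)
  have covered: "\<exists>P\<in>#M. v \<in> set P" if "v \<in> verts H" for v
  proof -
    have "v \<in># cover M"
      unfolding M(2) using that fin(1) by simp
    then show ?thesis
      by (auto simp: cover_def)
  qed
  have comp: "\<exists>P\<in>#M. P \<noteq> [] \<and> D = induced_subgraph H (set P)" if D: "D \<in> components H" for D
  proof -
    obtain C where C: "C \<in> verts H // connected_in H" "D = induced_subgraph H C"
      using D by (auto simp: components_def)
    then obtain u where u: "u \<in> verts H" "C = connected_in H `` {u}"
      by (auto elim: quotientE)
    obtain P where P_M: "P \<in># M" and uP: "u \<in> set P"
      using covered[OF u(1)] by blast
    have "C = set P"
      using conn[OF P_M uP] closed[OF P_M uP] unfolding u(2) connected_in_altdef by auto
    with C(2) P_M uP show ?thesis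
      by (intro bexI[of _ P]) auto
  qed
  show ?L
  proof
    show "\<forall>D\<in>components H. is_path D"
    proof
      fix D assume "D \<in> components H"
      then obtain P where P_M: "P \<in># M" "P \<noteq> []" and D: "D = induced_subgraph H (set P)"
        using comp by blast
      have "finite (edges D)" "verts D = set P" "end_pairs D = mset (links P)"
        using fin(2) P(2)[OF P_M(1)] induced[OF P_M(1)] by (auto simp: D induced_subgraph_def)
      then show "is_path D"
        using P(1)[OF P_M(1)] P_M(2) by (subst is_path_iff) auto
    qed
    have "components H \<subseteq> (\<lambda>P. induced_subgraph H (set P)) ` set_mset M"
      using comp by blast
    then have "num_components H \<le> card ((\<lambda>P. induced_subgraph H (set P)) ` set_mset M)"
      unfolding num_components_def by (intro card_mono) auto
    also have "\<dots> \<le> card (set_mset M)"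
      by (rule card_image_le) simp
    also have "\<dots> \<le> size M"
      by (induction M) (auto simp: card_insert_if le_SucI)
    finally show "num_components H \<le> a"
      unfolding M(1) .
  qed
qed

section \<open>Degrees in the complete multipartite multigraph\<close>
abbreviation parallel :: "nat \<Rightarrow> nat \<Rightarrow> nat \<times> nat \<Rightarrow> nat \<times> nat \<Rightarrow> nat" where
  "parallel lam mu u v \<equiv> if fst u = fst v then lam else mu"

lemma verts_K: "verts (K a p lam mu) = {..<p} \<times> {..<a}"
  by (simp add: K_def)

lemma ends_K: "ends (K a p lam mu) = fst"
  by (simp add: K_def)

lemma finite_edges_K: "finite (edges (K a p lam mu))"
  using loopless_multigraph_K by (auto simp: loopless_multigraph_def)

lemma edges_KD:
  assumes "e \<in> edges (K a p lam mu)"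
  shows "fst e \<subseteq> verts (K a p lam mu)" "card (fst e) = 2"
  using assms loopless_multigraph_K[of a p lam mu] unfolding loopless_multigraph_def ends_K by auto

lemma edges_K_subset: "edges (K a p lam mu) = {e \<in> edges (K a (Suc p) lam mu). fst e \<subseteq> {..<p} \<times> {..<a}}"
  by (subst K_induced_subgraph) (simp add: induced_subgraph_def ends_K)

text \<open>The vertices present when \<open>t\<close> vertices of the new part have been split off. The next one is
\<open>(p, t)\<close>, which doubles as the name of the merged vertex.\<close>
definition grown :: "nat \<Rightarrow> nat \<Rightarrow> nat \<Rightarrow> (nat \<times> nat) set" where
  "grown a p t = {..<p} \<times> {..<a} \<union> {p} \<times> {..<t}"

definition grown_edges :: "nat \<Rightarrow> nat \<Rightarrow> nat \<Rightarrow> nat \<Rightarrow> nat \<Rightarrow> ((nat \<times> nat) set \<times> nat) set" where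
  "grown_edges a p lam mu t = {e \<in> edges (K a (Suc p) lam mu). fst e \<subseteq> grown a p t}"

lemma finite_grown: "finite (grown a p t)"
  by (simp add: grown_def)

lemma grown_0: "grown a p 0 = {..<p} \<times> {..<a}"
  by (simp add: grown_def)

lemma grown_Suc: "grown a p (Suc t) = insert (p, t) (grown a p t)" "(p, t) \<notin> grown a p t"
  by (auto simp: grown_def)

lemma grown_full: "verts (K a (Suc p) lam mu) = grown a p a"
  by (auto simp: grown_def verts_K)

lemma grown_subset: "t \<le> a \<Longrightarrow> grown a p t \<subseteq> verts (K a (Suc p) lam mu)"
  by (auto simp: grown_def verts_K)

lemma finite_grown_edges: "finite (grown_edges a p lam mu t)"
  by (simp add: grown_edges_def finite_edges_K)

lemma grown_edges_0: "grown_edges a p lam mu 0 = edges (K a p lam mu)"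
  by (simp add: grown_edges_def grown_0 edges_K_subset[of a p])

lemma grown_edges_full: "grown_edges a p lam mu a = edges (K a (Suc p) lam mu)"
  using edges_KD(1)[of _ a "Suc p" lam mu] unfolding grown_edges_def grown_full by blast

lemma card_parallel_edges:
  assumes "t < a" "v \<in> grown a p t"
  shows "card {e \<in> edges (K a (Suc p) lam mu). fst e = {v, (p, t)}} = parallel lam mu v (p, t)"
proof -
  have "v \<in> verts (K a (Suc p) lam mu)" "(p, t) \<in> verts (K a (Suc p) lam mu)" "v \<noteq> (p, t)"
    using assms grown_subset[of t a p] grown_Suc(2)[of p t a] by (auto simp: verts_K)
  from card_edges_between_K[OF this] show ?thesis
    unfolding ends_K by simp
qed

lemma card_incident_edges:
  assumes t: "t \<le> a" and v: "v \<in> grown a p t"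
  shows "card {e \<in> grown_edges a p lam mu t. v \<in> fst e} =
    (\<Sum>u\<in>grown a p t - {v}. parallel lam mu u v)"
proof -
  let ?K = "K a (Suc p) lam mu"
  have "{e \<in> grown_edges a p lam mu t. v \<in> fst e} =
      (\<Union>u\<in>grown a p t - {v}. {e \<in> edges ?K. fst e = {u, v}})" (is "?A = ?B")
  proof (intro subset_antisym subsetI)
    fix e assume e: "e \<in> ?A"
    then have "card (fst e) = 2" "v \<in> fst e"
      using edges_KD(2)[of e a "Suc p" lam mu] by (auto simp: grown_edges_def)
    moreover obtain x y where "fst e = {x, y}" "x \<noteq> y"
      using \<open>card (fst e) = 2\<close> unfolding card_2_iff by blast
    ultimately obtain u where "u \<noteq> v" "fst e = {u, v}"
      by (metis insert_commute insertE singletonD)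
    with e show "e \<in> ?B"
      by (auto simp: grown_edges_def)
  qed (use v in \<open>auto simp: grown_edges_def\<close>)
  then have "card {e \<in> grown_edges a p lam mu t. v \<in> fst e} =
      card (\<Union>u\<in>grown a p t - {v}. {e \<in> edges ?K. fst e = {u, v}})"
    by (rule arg_cong)
  also have "\<dots> = (\<Sum>u\<in>grown a p t - {v}. card {e \<in> edges ?K. fst e = {u, v}})"
    by (intro card_UN_disjoint) (auto simp: finite_grown finite_edges_K doubleton_eq_iff)
  also have "\<dots> = (\<Sum>u\<in>grown a p t - {v}. parallel lam mu u v)"
  proof (rule sum.cong)
    fix u assume "u \<in> grown a p t - {v}"
    then have "u \<in> verts ?K" "v \<in> verts ?K" "u \<noteq> v"
      using v grown_subset[OF t] by auto
    from card_edges_between_K[OF this] show "card {e \<in> edges ?K. fst e = {u, v}} = parallel lam mu u v"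
      unfolding ends_K .
  qed simp
  finally show ?thesis .
qed

lemma sum_mult_old:
  "(\<Sum>u\<in>{..<p} \<times> {..<a}. parallel lam mu u v) =
    (if fst v < p then lam * a + mu * a * (p - 1) else mu * a * p)"
proof -
  have "(\<Sum>u\<in>{..<p} \<times> {..<a}. parallel lam mu u v) = (\<Sum>i<p. a * (if i = fst v then lam else mu))"
    by (subst sum.cartesian_product') simp
  also have "\<dots> = (if fst v < p then lam * a + mu * a * (p - 1) else mu * a * p)"
  proof (cases "fst v < p")
    case True
    then have "(\<Sum>i<p. a * (if i = fst v then lam else mu)) =
        a * lam + (\<Sum>i\<in>{..<p} - {fst v}. a * (if i = fst v then lam else mu))"
      by (subst sum.remove[of _ "fst v"]) auto
    also have "(\<Sum>i\<in>{..<p} - {fst v}. a * (if i = fst v then lam else mu)) = (p - 1) * (a * mu)"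
      using True by simp
    finally show ?thesis
      using True by (simp add: mult_ac)
  qed (simp add: mult_ac)
  finally show ?thesis .
qed

lemma sum_mult_grown:
  "(\<Sum>u\<in>grown a p t. parallel lam mu u v) =
    (if fst v < p then lam * a + mu * a * (p - 1) else mu * a * p) +
    t * (if fst v = p then lam else mu)"
proof -
  have "(\<Sum>u\<in>grown a p t. parallel lam mu u v) =
      (\<Sum>u\<in>{..<p} \<times> {..<a}. parallel lam mu u v) + (\<Sum>u\<in>{p} \<times> {..<t}. parallel lam mu u v)"
    unfolding grown_def by (intro sum.union_disjoint) auto
  also have "(\<Sum>u\<in>{p} \<times> {..<t}. parallel lam mu u v) = t * (if fst v = p then lam else mu)"
  proof -
    have "(\<Sum>u\<in>{p} \<times> {..<t}. parallel lam mu u v) = (\<Sum>u\<in>{p} \<times> {..<t}. if fst v = p then lam else mu)"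
      by (intro sum.cong) auto
    then show ?thesis
      by (simp add: card_cartesian_product)
  qed
  finally show ?thesis
    unfolding sum_mult_old .
qed

text \<open>All vertices have the same degree in the final multigraph, and the \<open>a - t\<close> vertices that are
still missing are joined to \<open>v\<close> by equally many edges each.\<close>
lemma degree_balance:
  assumes t: "t \<le> a" and v: "v \<in> grown a p t"
  shows "card {e \<in> grown_edges a p lam mu t. v \<in> fst e} + (a - t) * parallel lam mu v (p, t) =
    lam * (a - 1) + mu * a * p"
proof -
  have "(\<Sum>u\<in>grown a p t. parallel lam mu u v) =
      lam + card {e \<in> grown_edges a p lam mu t. v \<in> fst e}"
    unfolding card_incident_edges[OF assms]
    using v by (subst sum.remove[of _ v]) (auto simp: finite_grown)
  then have sum: "lam + card {e \<in> grown_edges a p lam mu t. v \<in> fst e} =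
      (if fst v < p then lam * a + mu * a * (p - 1) else mu * a * p) +
      t * (if fst v = p then lam else mu)"
    unfolding sum_mult_grown by simp
  obtain s where a: "a = t + s"
    using t le_Suc_ex by blast
  have "a > 0"
    using v t by (auto simp: grown_def)
  then obtain b where b: "a = Suc b"
    using gr0_conv_Suc by blast
  show ?thesis
  proof (cases "fst v < p")
    case True
    then obtain q where p: "p = Suc q"
      by (cases p) auto
    have "lam + (card {e \<in> grown_edges a p lam mu t. v \<in> fst e} + s * mu) =
        lam * a + mu * a * q + (t + s) * mu"
      using sum True p by (simp add: algebra_simps)
    also have "\<dots> = lam + (lam * b + mu * a * p)"
      unfolding a[symmetric] b p by (simp add: algebra_simps)
    finally have "card {e \<in> grown_edges a p lam mu t. v \<in> fst e} + s * mu = lam * b + mu * a * p"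
      by simp
    moreover have "a - t = s" "a - 1 = b"
      using a b by simp_all
    ultimately show ?thesis
      using True by simp
  next
    case False
    then have "fst v = p"
      using v by (auto simp: grown_def)
    then have "lam + (card {e \<in> grown_edges a p lam mu t. v \<in> fst e} + s * lam) =
        lam * (t + s) + mu * a * p"
      using sum by (simp add: algebra_simps)
    also have "\<dots> = lam + (lam * b + mu * a * p)"
      unfolding a[symmetric] b by (simp add: algebra_simps)
    finally have "card {e \<in> grown_edges a p lam mu t. v \<in> fst e} + s * lam = lam * b + mu * a * p"
      by simp
    moreover have "a - t = s" "a - 1 = b"
      using a b by simp_all
    ultimately show ?thesis
      using \<open>fst v = p\<close> by simp
  qed
qed

section \<open>From a path decomposition to Hamiltonian cycles\<close>
lemma size_option_mset:
  assumes "finite S" "set_mset T \<subseteq> insert None (Some ` S)"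
  shows "size T = count T None + (\<Sum>v\<in>S. count T (Some v))"
proof -
  have "size T = (\<Sum>x\<in>insert None (Some ` S). count T x)"
    unfolding size_multiset_overloaded_eq using assms
    by (intro sum.mono_neutral_left) (auto simp: not_in_iff)
  also have "\<dots> = count T None + (\<Sum>v\<in>S. count T (Some v))"
    using assms(1) by (subst sum.insert) (auto simp: sum.reindex)
  finally show ?thesis .
qed

text \<open>The number of edge ends that the next new vertex \<open>(p, t)\<close> takes over from each neighbour of the
merged vertex. The loops of the merged vertex stand for the edges among the \<open>a - t\<close> vertices in it,
so \<open>None\<close> contributes the edges from \<open>(p, t)\<close> to the remaining \<open>a - Suc t\<close> ones.\<close>
definition demand :: "nat \<Rightarrow> nat \<Rightarrow> nat \<Rightarrow> nat \<Rightarrow> nat \<Rightarrow> (nat \<times> nat) option \<Rightarrow> nat" where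
  "demand a p lam mu t x = (case x of None \<Rightarrow> lam * (a - Suc t)
     | Some v \<Rightarrow> if v \<in> grown a p t then parallel lam mu v (p, t) else 0)"

definition path_decomposition ::
    "nat \<Rightarrow> nat \<Rightarrow> nat \<Rightarrow> nat \<Rightarrow> nat \<Rightarrow> nat \<Rightarrow> (nat \<Rightarrow> (nat \<times> nat) list multiset) \<Rightarrow> bool" where
  "path_decomposition a p lam mu k t M \<longleftrightarrow>
     (\<forall>j\<in>{1..k}. size (M j) = a - t \<and> cover (M j) = mset_set (grown a p t)) \<and>
     (\<Sum>j\<in>{1..k}. linkage (M j)) = image_mset fst (mset_set (grown_edges a p lam mu t))"

text \<open>This provides the divisibility by the number \<open>a - t\<close> of merged vertices that \<open>detach_vertex\<close> asks for.
At an old vertex, the tips make up for the difference between \<open>2 * k\<close> and its degree.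
The number of loop ends is what remains of the \<open>2 * (a - t)\<close> tips of each colour.\<close>
lemma count_tips:
  assumes k: "2 * k = lam * (a - 1) + mu * a * p" and t: "t < a"
    and M: "path_decomposition a p lam mu k t M"
  shows "count (\<Sum>j\<in>{1..k}. tips (M j)) x = (a - t) * demand a p lam mu t x"
proof -
  let ?T = "\<Sum>j\<in>{1..k}. tips (M j)"
  have size: "size (M j) = a - t" and cov: "cover (M j) = mset_set (grown a p t)" if "j \<in> {1..k}" for j
    using M that by (auto simp: path_decomposition_def)
  have sub: "set P \<subseteq> grown a p t" "distinct P" if "j \<in> {1..k}" "P \<in># M j" for j P
    using cover_eq_mset_setD[OF cov[OF that(1)] that(2)] finite_grown by auto
  have T: "set_mset ?T \<subseteq> insert None (Some ` grown a p t)"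
  proof
    fix y assume "y \<in># ?T"
    then obtain j P where "j \<in> {1..k}" "P \<in># M j" "y = tip 0 P \<or> y = tip 1 P"
      by (auto simp: in_tips_iff set_mset_sum)
    moreover from this have "hd P \<in> grown a p t \<and> last P \<in> grown a p t" if "P \<noteq> []"
      using sub(1)[of j P] that by (auto dest: subsetD)
    ultimately show "y \<in> insert None (Some ` grown a p t)"
      by (auto simp: tip_def split: if_splits)
  qed
  have Some: "count ?T (Some v) = (a - t) * parallel lam mu v (p, t)" if v: "v \<in> grown a p t" for v
  proof -
    have "(\<Sum>j\<in>{1..k}. deg v (linkage (M j)) + count (tips (M j)) (Some v)) = (\<Sum>j\<in>{1..k}. 2)"
      using sub(2) v
      by (intro sum.cong refl, subst deg_linkage_plus_tips) (auto simp: cov finite_grown)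
    then have "deg v (\<Sum>j\<in>{1..k}. linkage (M j)) + count ?T (Some v) = 2 * k"
      by (simp add: sum.distrib deg_sum count_sum)
    then have "card {e \<in> grown_edges a p lam mu t. v \<in> fst e} + count ?T (Some v) = 2 * k"
      using M unfolding path_decomposition_def by (simp add: deg_image_mset_set finite_grown_edges)
    with degree_balance[of t a v p lam mu] t v k show ?thesis
      by simp
  qed
  show ?thesis
  proof (cases x)
    case None
    have "2 * k * (a - t) = size ?T"
      using size by (simp add: size_tips)
    also have "\<dots> = count ?T None + (\<Sum>v\<in>grown a p t. (a - t) * parallel lam mu v (p, t))"
      using size_option_mset[OF finite_grown T] Some by simp
    also have "(\<Sum>v\<in>grown a p t. (a - t) * parallel lam mu v (p, t)) = (a - t) * (mu * a * p + t * lam)"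
      by (subst sum_distrib_left[symmetric], subst sum_mult_grown) simp
    finally have eq: "2 * k * (a - t) = count ?T None + (a - t) * (mu * a * p + t * lam)" .
    obtain s where "a = Suc (t + s)"
      using t less_imp_Suc_add by blast
    then have "count ?T None + (a - t) * (mu * a * p + t * lam) =
        (a - t) * (lam * (a - Suc t)) + (a - t) * (mu * a * p + t * lam)"
      unfolding eq[symmetric] k by (simp add: algebra_simps)
    then show ?thesis
      by (simp add: None demand_def)
  next
    case (Some v)
    show ?thesis
    proof (cases "v \<in> grown a p t")
      case False
      then have "Some v \<notin># ?T"
        using T by auto
      then show ?thesis
        using False Some by (simp add: demand_def not_in_iff)
    qed (use Some \<open>\<And>v. v \<in> grown a p t \<Longrightarrow> count ?T (Some v) = (a - t) * parallel lam mu v (p, t)\<close>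
        in \<open>simp add: demand_def\<close>)
  qed
qed

lemma sum_spokes:
  assumes "finite S" "\<And>v. Some v \<in># D \<Longrightarrow> v \<in> S"
  shows "(\<Sum>x\<in>#D. spoke w x) = (\<Sum>v\<in>S. replicate_mset (count D (Some v)) {v, w})"
  using assms(2)
proof (induction D)
  case (add x D)
  show ?case
  proof (cases x)
    case None
    with add show ?thesis by (simp add: spoke_def)
  next
    case (Some u)
    with add.prems have "u \<in> S" by simp
    have "(\<Sum>v\<in>S. replicate_mset (count (add_mset x D) (Some v)) {v, w}) =
        (\<Sum>v\<in>S. replicate_mset (count D (Some v)) {v, w} + (if u = v then {#{v, w}#} else {#}))"
      by (intro sum.cong) (auto simp: Some)
    also have "\<dots> = (\<Sum>x\<in>#D. spoke w x) + {#{u, w}#}"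
      using add \<open>u \<in> S\<close> assms(1) by (simp add: sum.distrib)
    finally show ?thesis
      by (simp add: Some spoke_def)
  qed
qed simp

lemma grow_edges:
  assumes t: "t < a" and D: "\<And>x. count D x = demand a p lam mu t x"
  shows "image_mset fst (mset_set (grown_edges a p lam mu t)) + (\<Sum>x\<in>#D. spoke (p, t) x) =
    image_mset fst (mset_set (grown_edges a p lam mu (Suc t)))"
proof -
  let ?S = "grown a p t" and ?w = "(p, t)"
  let ?N = "\<lambda>v. {e \<in> edges (K a (Suc p) lam mu). fst e = {v, ?w}}"
  have "(\<Sum>x\<in>#D. spoke ?w x) = (\<Sum>v\<in>?S. replicate_mset (count D (Some v)) {v, ?w})"
  proof (rule sum_spokes[OF finite_grown])
    fix v assume "Some v \<in># D"
    then show "v \<in> ?S"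
      using D[of "Some v"] by (auto simp: demand_def simp flip: count_greater_zero_iff split: if_splits)
  qed
  also have "\<dots> = (\<Sum>v\<in>?S. image_mset fst (mset_set (?N v)))"
  proof (rule sum.cong)
    fix v assume v: "v \<in> ?S"
    have "image_mset fst (mset_set (?N v)) = image_mset (\<lambda>_. {v, ?w}) (mset_set (?N v))"
      by (rule image_mset_cong) (simp add: finite_edges_K)
    then show "replicate_mset (count D (Some v)) {v, ?w} = image_mset fst (mset_set (?N v))"
      using v t by (simp add: D demand_def image_mset_const_eq card_parallel_edges)
  qed simp
  also have "\<dots> = image_mset fst (\<Sum>v\<in>?S. mset_set (?N v))"
    by (induction rule: infinite_finite_induct) simp_all
  also have "(\<Sum>v\<in>?S. mset_set (?N v)) = mset_set (\<Union>v\<in>?S. ?N v)"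
    by (rule mset_set_UN_disjoint[symmetric]) (auto simp: finite_grown finite_edges_K doubleton_eq_iff)
  finally have spokes: "(\<Sum>x\<in>#D. spoke ?w x) = image_mset fst (mset_set (\<Union>v\<in>?S. ?N v))" .
  have "grown_edges a p lam mu (Suc t) = grown_edges a p lam mu t \<union> (\<Union>v\<in>?S. ?N v)"
  proof (intro subset_antisym subsetI)
    fix e assume e: "e \<in> grown_edges a p lam mu (Suc t)"
    then have "card (fst e) = 2" "fst e \<subseteq> insert ?w ?S" and e': "e \<in> edges (K a (Suc p) lam mu)"
      using edges_KD(2)[of e a "Suc p" lam mu] by (auto simp: grown_edges_def grown_Suc)
    then obtain x y where xy: "fst e = {x, y}" "x \<noteq> y" "x \<in> insert ?w ?S" "y \<in> insert ?w ?S"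
      unfolding card_2_iff by blast
    then consider "x \<in> ?S" "y \<in> ?S" | "x = ?w" "y \<in> ?S" | "y = ?w" "x \<in> ?S"
      by blast
    then have "fst e \<subseteq> ?S \<or> (\<exists>v\<in>?S. fst e = {v, ?w})"
      unfolding xy(1) by cases blast+
    with e' show "e \<in> grown_edges a p lam mu t \<union> (\<Union>v\<in>?S. ?N v)"
      by (auto simp: grown_edges_def)
  qed (auto simp: grown_edges_def grown_Suc)
  moreover have "grown_edges a p lam mu t \<inter> (\<Union>v\<in>?S. ?N v) = {}"
    using grown_Suc(2)[of p t a] by (auto simp: grown_edges_def)
  ultimately show ?thesis
    unfolding spokes by (simp add: mset_set_Union finite_grown_edges finite_grown finite_edges_K)
qed

lemma filter_spokes:
  assumes "w \<notin> V"
  shows "filter_mset (\<lambda>X. X \<subseteq> V) (\<Sum>x\<in>#D. spoke w x) = {#}"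
  using assms by (induction D) (auto simp: spoke_def split: option.split)

text \<open>A link created on the way contains a new vertex, so the colours of the given edges are never changed.\<close>
lemma grow_path_decomposition:
  assumes k: "2 * k = lam * (a - 1) + mu * a * p"
    and M: "path_decomposition a p lam mu k 0 M" and t: "t < a"
  shows "\<exists>N. path_decomposition a p lam mu k t N \<and>
    (\<forall>j\<in>{1..k}. filter_mset (\<lambda>X. X \<subseteq> {..<p} \<times> {..<a}) (linkage (N j)) = linkage (M j))"
  using t
proof (induction t)
  case 0
  have "filter_mset (\<lambda>X. X \<subseteq> {..<p} \<times> {..<a}) (linkage (M j)) = linkage (M j)" if "j \<in> {1..k}" for j
  proof -
    have "cover (M j) = mset_set ({..<p} \<times> {..<a})"
      using M that by (simp add: path_decomposition_def grown_0)
    then show ?thesis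
      using in_linkage_coverD(1)[of "M j" "{..<p} \<times> {..<a}"] by (auto simp: filter_mset_eq_conv)
  qed
  with M show ?case by blast
next
  case (Suc t)
  let ?V = "{..<p} \<times> {..<a}"
  obtain N where N: "path_decomposition a p lam mu k t N"
    and NM: "\<And>j. j \<in> {1..k} \<Longrightarrow> filter_mset (\<lambda>X. X \<subseteq> ?V) (linkage (N j)) = linkage (M j)"
    using Suc by auto
  have t: "t < a" "a - t \<ge> 2"
    using Suc.prems by auto
  have size: "size (N j) = a - t" and cov: "cover (N j) = mset_set (grown a p t)" if "j \<in> {1..k}" for j
    using N that by (auto simp: path_decomposition_def)
  obtain N' B where N': "\<And>j. j \<in> {1..k} \<Longrightarrow> size (N' j) = a - t - 1"
      "\<And>j. j \<in> {1..k} \<Longrightarrow> cover (N' j) = add_mset (p, t) (cover (N j))"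
      "\<And>j. j \<in> {1..k} \<Longrightarrow> linkage (N' j) = linkage (N j) + (\<Sum>x\<in>#B j. spoke (p, t) x)"
    and B: "\<And>x. count (\<Sum>j\<in>{1..k}. B j) x = demand a p lam mu t x"
    using detach_vertex[OF _ t(2) size count_tips[OF k t(1) N], where w = "(p, t)"] by blast
  have "(\<Sum>j\<in>{1..k}. \<Sum>x\<in>#B j. spoke (p, t) x) = (\<Sum>x\<in>#(\<Sum>j\<in>{1..k}. B j). spoke (p, t) x)"
    by (induction rule: infinite_finite_induct) simp_all
  then have "(\<Sum>j\<in>{1..k}. linkage (N' j)) =
      image_mset fst (mset_set (grown_edges a p lam mu t)) + (\<Sum>x\<in>#(\<Sum>j\<in>{1..k}. B j). spoke (p, t) x)"
    using N N'(3) by (simp add: sum.distrib path_decomposition_def)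
  also have "\<dots> = image_mset fst (mset_set (grown_edges a p lam mu (Suc t)))"
    by (rule grow_edges[OF t(1) B])
  finally have "path_decomposition a p lam mu k (Suc t) N'"
    using N'(1,2) cov grown_Suc(2)[of p t a]
    by (simp add: path_decomposition_def grown_Suc(1) finite_grown)
  moreover have "filter_mset (\<lambda>X. X \<subseteq> ?V) (linkage (N' j)) = linkage (M j)" if "j \<in> {1..k}" for j
    using N'(3)[OF that] NM[OF that] by (simp add: filter_spokes)
  ultimately show ?case by blast
qed

text \<open>A cycle is a path on its other vertices, closed up through \<open>w\<close>. With \<open>zs = []\<close> this
closes the last petal; for general lists it opens a cycle at \<open>w\<close>.\<close>
lemma cycle_links_rotate:
  assumes "ys @ zs \<noteq> []"
  shows "mset (cycle_links (ys @ w # zs)) =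
    mset (links (zs @ ys)) + spoke w (tip 0 (zs @ ys)) + spoke w (tip 1 (zs @ ys))"
proof -
  have single: "mset (links (y # ys)) = spoke y (tip 0 ys) + mset (links ys)" for y :: 'a and ys
    using mset_links_insert[of "[]" y ys] by (simp add: tip_def spoke_def)
  have snoc: "mset (links (ys @ [y])) = mset (links ys) + spoke y (tip 1 ys)" for y :: 'a and ys
    using mset_links_insert[of ys y "[]"] by (simp add: tip_def spoke_def)
  show ?thesis
  proof (cases ys)
    case Nil
    with assms have "tip 0 (zs @ [w]) = tip 0 zs"
      by (simp add: tip_def)
    then show ?thesis
      by (simp add: Nil cycle_links_def single snoc)
  next
    case (Cons y xs)
    have "tip 0 (zs @ y # xs) = tip 0 (zs @ [y])" "tip 1 (zs @ y # xs) = tip 1 (y # xs)"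
      by (auto simp: tip_def hd_append)
    then show ?thesis
      using mset_links_insert[of ys w "zs @ [y]"] mset_links_insert[of zs y xs]
      by (simp add: Cons cycle_links_def single snoc ac_simps)
  qed
qed

section \<open>Embeddings and path decompositions\<close>
lemma end_pairs_color_class:
  "end_pairs (color_class (K a p lam mu) c j) =
    image_mset fst (mset_set {e \<in> edges (K a p lam mu). c e = j})"
  by (simp add: color_class_def ends_K)

lemma linear_forest_iff_path_system_color_class:
  "(\<forall>H\<in>components (color_class (K a p lam mu) c j). is_path H) \<and>
      num_components (color_class (K a p lam mu) c j) \<le> a \<longleftrightarrow>
    (\<exists>M. size M = a \<and> cover M = mset_set (grown a p 0) \<and>
      linkage M = image_mset fst (mset_set {e \<in> edges (K a p lam mu). c e = j}))"
proof -
  have "loopless_multigraph (color_class (K a p lam mu) c j)"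
    using loopless_multigraph_K[of a p lam mu] by (auto simp: loopless_multigraph_def color_class_def)
  from linear_forest_iff_path_system[OF this, of a] show ?thesis
    unfolding end_pairs_color_class by (simp add: color_class_def verts_K grown_0)
qed

lemma sum_color_classes:
  assumes "finite E" "\<forall>e\<in>E. c e \<in> {1..k::nat}"
  shows "(\<Sum>j\<in>{1..k}. image_mset f (mset_set {e \<in> E. c e = j})) = image_mset f (mset_set E)"
proof -
  have "(\<Sum>j\<in>{1..k}. image_mset f (mset_set {e \<in> E. c e = j})) =
      image_mset f (\<Sum>j\<in>{1..k}. mset_set {e \<in> E. c e = j})"
    by (induction rule: infinite_finite_induct) simp_all
  also have "(\<Sum>j\<in>{1..k}. mset_set {e \<in> E. c e = j}) = mset_set (\<Union>j\<in>{1..k}. {e \<in> E. c e = j})"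
    using assms(1) by (intro mset_set_UN_disjoint[symmetric]) auto
  also have "(\<Union>j\<in>{1..k}. {e \<in> E. c e = j}) = E"
    using assms(2) by auto
  finally show ?thesis .
qed

lemma path_decompositionD:
  assumes "path_decomposition a p lam mu k t M" "j \<in> {1..k}"
  shows "size (M j) = a - t" "cover (M j) = mset_set (grown a p t)"
  using assms unfolding path_decomposition_def by blast+

text \<open>At the last stage the merged vertex is the single vertex \<open>(p, a - 1)\<close>. It takes over all edge
ends; loops are absent, because \<open>demand\<close> is zero at \<open>None\<close>, and each colour has one petal left.\<close>
lemma path_decomposition_close:
  assumes k: "2 * k = lam * (a - 1) + mu * a * p" and a: "a > 0" and p: "p > 0"
    and N: "path_decomposition a p lam mu k (a - 1) N"
  shows "\<exists>C. (\<forall>j\<in>{1..k}. distinct (C j) \<and> 2 \<le> length (C j) \<and>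
      set (C j) = verts (K a (Suc p) lam mu) \<and>
      filter_mset (\<lambda>X. X \<subseteq> {..<p} \<times> {..<a}) (mset (cycle_links (C j))) =
        filter_mset (\<lambda>X. X \<subseteq> {..<p} \<times> {..<a}) (linkage (N j))) \<and>
    (\<Sum>j\<in>{1..k}. mset (cycle_links (C j))) = image_mset fst (mset_set (edges (K a (Suc p) lam mu)))"
proof -
  let ?w = "(p, a - 1)" and ?V = "{..<p} \<times> {..<a}"
  have a': "a - 1 < a" "Suc (a - 1) = a" "a - (a - 1) = 1"
    using a by simp_all
  have "\<exists>P. N j = {#P#}" if "j \<in> {1..k}" for j
  proof (rule size_1_singleton_mset)
    show "size (N j) = 1"
      using path_decompositionD(1)[OF N that] unfolding a'(3) .
  qed
  then have "\<exists>P. \<forall>j\<in>{1..k}. N j = {#P j#}"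
    by (intro bchoice) blast
  then obtain P where P: "\<And>j. j \<in> {1..k} \<Longrightarrow> N j = {#P j#}"
    by blast
  have cov: "mset (P j) = mset_set (grown a p (a - 1))" if "j \<in> {1..k}" for j
    using path_decompositionD(2)[OF N that] P[OF that] by simp
  have set_P: "set (P j) = grown a p (a - 1)" and dist: "distinct (P j)" if "j \<in> {1..k}" for j
  proof -
    show "set (P j) = grown a p (a - 1)"
      using cov[OF that] by (metis finite_grown finite_set_mset_mset_set set_mset_mset)
    show "distinct (P j)"
      using cover_eq_mset_setD(1)[of "{#P j#}" _ "P j"] cov[OF that] by simp
  qed
  have "(0, 0) \<in> grown a p (a - 1)"
    using a p by (simp add: grown_def)
  then have nonempty: "P j \<noteq> []" if "j \<in> {1..k}" for j
    using set_P[OF that] by auto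
  define C where "C j = P j @ [?w]" for j
  have links: "mset (cycle_links (C j)) = linkage (N j) + (\<Sum>x\<in>#tips (N j). spoke ?w x)"
    if "j \<in> {1..k}" for j
    using cycle_links_rotate[of "P j" "[]" ?w] nonempty[OF that] by (simp add: C_def P[OF that])
  have "(\<Sum>j\<in>{1..k}. \<Sum>x\<in>#tips (N j). spoke ?w x) = (\<Sum>x\<in>#(\<Sum>j\<in>{1..k}. tips (N j)). spoke ?w x)"
    by (induction rule: infinite_finite_induct) simp_all
  then have "(\<Sum>j\<in>{1..k}. mset (cycle_links (C j))) =
      image_mset fst (mset_set (grown_edges a p lam mu (a - 1))) +
      (\<Sum>x\<in>#(\<Sum>j\<in>{1..k}. tips (N j)). spoke ?w x)"
    using N links by (simp add: sum.distrib path_decomposition_def)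
  also have "\<dots> = image_mset fst (mset_set (grown_edges a p lam mu (Suc (a - 1))))"
    using count_tips[OF k a'(1) N] unfolding a'(3) by (intro grow_edges a') simp
  finally have "(\<Sum>j\<in>{1..k}. mset (cycle_links (C j))) =
      image_mset fst (mset_set (edges (K a (Suc p) lam mu)))"
    unfolding a'(2) grown_edges_full .
  moreover have "distinct (C j)" "2 \<le> length (C j)" "set (C j) = verts (K a (Suc p) lam mu)"
    if "j \<in> {1..k}" for j
  proof -
    show "distinct (C j)"
      using dist[OF that] set_P[OF that] grown_Suc(2)[of p "a - 1" a] by (simp add: C_def)
    show "2 \<le> length (C j)"
      using nonempty[OF that] by (cases "P j") (simp_all add: C_def)
    show "set (C j) = verts (K a (Suc p) lam mu)"
      using grown_Suc(1)[of a p "a - 1"] unfolding a'(2) C_def grown_full set_append set_P[OF that]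
      by simp
  qed
  moreover have "filter_mset (\<lambda>X. X \<subseteq> ?V) (mset (cycle_links (C j))) =
      filter_mset (\<lambda>X. X \<subseteq> ?V) (linkage (N j))" if "j \<in> {1..k}" for j
    using links[OF that] by (simp add: filter_spokes)
  ultimately show ?thesis
    by blast
qed

text \<open>The cycles prescribe how often each colour is used on each pair of ends. Inside the old parts the given
colouring obeys this prescription, so only the edges at new vertices remain to be coloured.\<close>
lemma embeddable_if_path_decomposition:
  assumes k: "2 * k = lam * (a - 1) + mu * a * p" and a: "a > 0" and p: "p > 0"
    and c: "edge_coloring (K a p lam mu) k c"
    and M: "path_decomposition a p lam mu k 0 M"
      "\<And>j. j \<in> {1..k} \<Longrightarrow> linkage (M j) = image_mset fst (mset_set {e \<in> edges (K a p lam mu). c e = j})"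
  shows "embeddable (K a p lam mu) k c (K a (Suc p) lam mu)"
proof -
  let ?V = "{..<p} \<times> {..<a}" and ?G = "K a p lam mu" and ?K = "K a (Suc p) lam mu"
  obtain N where N: "path_decomposition a p lam mu k (a - 1) N"
    and NM: "\<And>j. j \<in> {1..k} \<Longrightarrow> filter_mset (\<lambda>X. X \<subseteq> ?V) (linkage (N j)) = linkage (M j)"
    using grow_path_decomposition[OF k M(1), of "a - 1"] a by auto
  obtain C where C: "\<And>j. j \<in> {1..k} \<Longrightarrow> distinct (C j)" "\<And>j. j \<in> {1..k} \<Longrightarrow> 2 \<le> length (C j)"
      "\<And>j. j \<in> {1..k} \<Longrightarrow> set (C j) = verts ?K"
      "\<And>j. j \<in> {1..k} \<Longrightarrow> filter_mset (\<lambda>X. X \<subseteq> ?V) (mset (cycle_links (C j))) =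
        filter_mset (\<lambda>X. X \<subseteq> ?V) (linkage (N j))"
    and sum: "(\<Sum>j\<in>{1..k}. mset (cycle_links (C j))) = image_mset fst (mset_set (edges ?K))"
    using path_decomposition_close[OF k a p N] by blast
  define L where "L j = filter_mset (\<lambda>X. \<not> X \<subseteq> ?V) (mset (cycle_links (C j)))" for j
  let ?E = "{e \<in> edges ?K. \<not> fst e \<subseteq> ?V}"
  have "(\<Sum>j\<in>{1..k}. L j) = filter_mset (\<lambda>X. \<not> X \<subseteq> ?V) (\<Sum>j\<in>{1..k}. mset (cycle_links (C j)))"
    unfolding L_def by (induction rule: infinite_finite_induct) simp_all
  also have "\<dots> = image_mset fst (mset_set ?E)"
    unfolding sum by (simp add: filter_mset_image_mset finite_edges_K)
  finally obtain d where d: "\<forall>e\<in>?E. d e \<in> {1..k}"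
      "\<And>j. j \<in> {1..k} \<Longrightarrow> image_mset fst (mset_set {e \<in> ?E. d e = j}) = L j"
    using split_colours[of "{1..k}" ?E L fst] finite_edges_K by auto
  define c' where "c' e = (if fst e \<subseteq> ?V then c e else d e)" for e
  have "is_cycle (color_class ?K c' j)" if j: "j \<in> {1..k}" for j
  proof -
    have "mset (cycle_links (C j)) =
        filter_mset (\<lambda>X. X \<subseteq> ?V) (mset (cycle_links (C j))) + L j"
      unfolding L_def by (rule multiset_partition)
    also have "\<dots> = image_mset fst (mset_set {e \<in> edges ?G. c e = j}) +
        image_mset fst (mset_set {e \<in> ?E. d e = j})"
      using C(4)[OF j] NM[OF j] M(2)[OF j] d(2)[OF j] by simp
    also have "\<dots> = image_mset fst (mset_set ({e \<in> edges ?G. c e = j} \<union> {e \<in> ?E. d e = j}))"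
      using edges_K_subset[of a p lam mu] finite_edges_K
      by (subst mset_set_Union) auto
    also have "{e \<in> edges ?G. c e = j} \<union> {e \<in> ?E. d e = j} = {e \<in> edges ?K. c' e = j}"
      using edges_K_subset[of a p lam mu] by (auto simp: c'_def)
    finally have "end_pairs (color_class ?K c' j) = mset (cycle_links (C j))"
      unfolding end_pairs_color_class by simp
    then show ?thesis
      using C(1-3)[OF j] finite_edges_K
      by (subst is_cycle_iff) (auto simp: color_class_def)
  qed
  moreover have "edge_coloring ?K k c'"
    unfolding edge_coloring_def
  proof
    fix e assume e: "e \<in> edges ?K"
    show "c' e \<in> {1..k}"
    proof (cases "fst e \<subseteq> ?V")
      case True
      with e have "e \<in> edges ?G"
        using edges_K_subset[of a p lam mu] by blast
      with True c show ?thesis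
        by (simp add: c'_def edge_coloring_def)
    next
      case False
      with e d(1) have "d e \<in> {1..k}"
        by blast
      with False show ?thesis
        by (simp add: c'_def)
    qed
  qed
  moreover have "\<forall>e\<in>edges ?G. c' e = c e"
    using edges_K_subset[of a p lam mu] by (auto simp: c'_def)
  ultimately show ?thesis
    unfolding embeddable_def hamiltonian_decomposition_def by blast
qed

text \<open>Open each Hamiltonian cycle at the new vertex \<open>(p, 0)\<close> and cut the resulting path at the
other \<open>a - 1\<close> new vertices, which gives \<open>a\<close> pieces.\<close>
lemma path_decomposition_if_embeddable:
  assumes a: "a > 0" and p: "p > 0"
    and emb: "embeddable (K a p lam mu) k c (K a (Suc p) lam mu)"
  shows "2 * k = lam * (a - 1) + mu * a * p"
    and "\<exists>M. \<forall>j\<in>{1..k}. size (M j) = a \<and> cover (M j) = mset_set (grown a p 0) \<and>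
      linkage (M j) = image_mset fst (mset_set {e \<in> edges (K a p lam mu). c e = j})"
proof -
  let ?V = "{..<p} \<times> {..<a}" and ?W = "{p} \<times> {..<a}" and ?w = "(p, 0)"
  let ?G = "K a p lam mu" and ?K = "K a (Suc p) lam mu"
  obtain c' where c': "edge_coloring ?K k c'" "\<And>j. j \<in> {1..k} \<Longrightarrow> is_cycle (color_class ?K c' j)"
      "\<And>e. e \<in> edges ?G \<Longrightarrow> c' e = c e"
    using emb unfolding embeddable_def hamiltonian_decomposition_def by blast
  let ?L = "\<lambda>j. image_mset fst (mset_set {e \<in> edges ?K. c' e = j})"
  have "\<exists>P. distinct P \<and> set P = verts ?K - {?w} \<and>
      ?L j = mset (links P) + spoke ?w (tip 0 P) + spoke ?w (tip 1 P)" if j: "j \<in> {1..k}" for j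
  proof -
    obtain vs where vs: "2 \<le> length vs" "distinct vs" "verts ?K = set vs" "?L j = mset (cycle_links vs)"
      using c'(2)[OF j] finite_edges_K
      by (subst (asm) is_cycle_iff) (auto simp: color_class_def ends_K)
    have "?w \<in> set vs"
      using a unfolding vs(3)[symmetric] verts_K by simp
    then obtain ys zs where w: "vs = ys @ ?w # zs"
      by (meson split_list)
    have "ys @ zs \<noteq> []"
      using vs(1) unfolding w by auto
    from cycle_links_rotate[OF this, of ?w] show ?thesis
      using vs unfolding w by (intro exI[of _ "zs @ ys"]) auto
  qed
  then have "\<exists>P. \<forall>j\<in>{1..k}. distinct (P j) \<and> set (P j) = verts ?K - {?w} \<and>
      ?L j = mset (links (P j)) + spoke ?w (tip 0 (P j)) + spoke ?w (tip 1 (P j))"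
    by (intro bchoice) blast
  then obtain P where P: "\<And>j. j \<in> {1..k} \<Longrightarrow> distinct (P j)"
      "\<And>j. j \<in> {1..k} \<Longrightarrow> set (P j) = verts ?K - {?w}"
      "\<And>j. j \<in> {1..k} \<Longrightarrow> ?L j = mset (links (P j)) + spoke ?w (tip 0 (P j)) + spoke ?w (tip 1 (P j))"
    by blast
  show "2 * k = lam * (a - 1) + mu * a * p"
  proof -
    let ?v = "(0, 0)"
    have v: "?v \<in> grown a p a" "?v \<noteq> ?w"
      using a p by (auto simp: grown_def)
    have "deg ?v (?L j) = 2" if j: "j \<in> {1..k}" for j
    proof -
      have "count (mset (P j)) ?v = 1"
        using P(1,2)[OF j] v unfolding grown_full by (simp add: distinct_count_atmost_1)
      moreover have "deg ?v (?L j) =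
          deg ?v (mset (links (P j))) + count {#tip 0 (P j), tip 1 (P j)#} (Some ?v)"
        unfolding P(3)[OF j] deg_simps(2) deg_spoke[OF v(2)] by simp
      ultimately show ?thesis
        using deg_links_plus_tips[OF P(1)[OF j], of ?v] by simp
    qed
    then have "2 * k = deg ?v (\<Sum>j\<in>{1..k}. ?L j)"
      by (simp add: deg_sum)
    also have "(\<Sum>j\<in>{1..k}. ?L j) = image_mset fst (mset_set (edges ?K))"
      using c'(1) by (intro sum_color_classes finite_edges_K) (auto simp: edge_coloring_def)
    also have "deg ?v \<dots> = lam * (a - 1) + mu * a * p"
      using degree_balance[of a a ?v p lam mu] v(1)
      by (simp add: deg_image_mset_set finite_edges_K grown_edges_full)
    finally show ?thesis .
  qed
  have "\<exists>M. size M = a \<and> cover M = mset_set (grown a p 0) \<and>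
      linkage M = image_mset fst (mset_set {e \<in> edges ?G. c e = j})" if j: "j \<in> {1..k}" for j
  proof -
    obtain M where M: "size M = Suc (card (set (P j) \<inter> ?W))"
        "cover M = filter_mset (\<lambda>x. x \<notin> ?W) (mset (P j))"
        "linkage M = filter_mset (\<lambda>X. X \<inter> ?W = {}) (mset (links (P j)))"
      using cut_path[OF P(1)[OF j], of ?W] by blast
    have "set (P j) \<inter> ?W = ?W - {?w}"
      unfolding P(2)[OF j] verts_K by auto
    then have "size M = a"
      using M(1) a by (simp add: card_cartesian_product)
    moreover have "cover M = mset_set (grown a p 0)"
    proof -
      have "cover M = mset_set {x \<in> set (P j). x \<notin> ?W}"
        unfolding M(2) mset_set_set[OF P(1)[OF j], symmetric] by simp
      also have "{x \<in> set (P j). x \<notin> ?W} = grown a p 0"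
        unfolding P(2)[OF j] verts_K grown_0 by auto
      finally show ?thesis .
    qed
    moreover have "linkage M = image_mset fst (mset_set {e \<in> edges ?G. c e = j})"
    proof -
      have "filter_mset (\<lambda>X. X \<inter> ?W = {}) (spoke ?w x) = {#}" for x
        using a by (auto simp: spoke_def split: option.split)
      then have "linkage M = filter_mset (\<lambda>X. X \<inter> ?W = {}) (?L j)"
        unfolding M(3) P(3)[OF j] by simp
      also have "\<dots> = image_mset fst (mset_set {e \<in> edges ?K. c' e = j \<and> fst e \<inter> ?W = {}})"
        using finite_edges_K by (simp add: filter_mset_image_mset)
      also have "{e \<in> edges ?K. c' e = j \<and> fst e \<inter> ?W = {}} = {e \<in> edges ?G. c e = j}"
      proof -
        have "fst e \<inter> ?W = {} \<longleftrightarrow> fst e \<subseteq> ?V" if "e \<in> edges ?K" for e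
          using edges_KD(1)[OF that] unfolding grown_full grown_def by auto
        then show ?thesis
          using edges_K_subset[of a p lam mu] c'(3) by auto
      qed
      finally show ?thesis .
    qed
    ultimately show ?thesis by blast
  qed
  then show "\<exists>M. \<forall>j\<in>{1..k}. size (M j) = a \<and> cover (M j) = mset_set (grown a p 0) \<and>
      linkage (M j) = image_mset fst (mset_set {e \<in> edges ?G. c e = j})"
    by (intro bchoice) blast
qed

text \<open>In each colour some petal is nonempty, so there are at most \<open>a - 1\<close> loops at the merged vertex. All colours
together have as many loops as there are edges in the new part, namely \<open>lam * (a choose 2)\<close>.
Hence \<open>a * lam \<le> 2 * k\<close>.\<close>
lemma lam_le_of_path_decomposition:
  assumes k: "2 * k = lam * (a - 1) + mu * a * p" and a: "a > 1" and p: "p > 0"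
    and M: "path_decomposition a p lam mu k 0 M"
  shows "lam \<le> mu * a * p"
proof -
  have None: "count (tips (M j)) None \<le> 2 * (a - 1)" if j: "j \<in> {1..k}" for j
  proof -
    have "(0, 0) \<in># cover (M j)"
      unfolding path_decompositionD(2)[OF M j] using a p by (simp add: grown_def)
    then obtain P where "P \<in># M j" "(0, 0) \<in> set P"
      unfolding cover_def by auto
    then have P: "P \<in># M j" "P \<noteq> []"
      by auto
    then obtain N where N: "M j = add_mset P N"
      by (blast dest: multi_member_split)
    have "count (tips (M j)) None = count (tips N) None"
      using P(2) by (simp add: N tip_def)
    also have "\<dots> \<le> 2 * size N"
      using count_le_size[of "tips N" None] by (simp add: size_tips)
    also have "size N = a - 1"
      using path_decompositionD(1)[OF M j] by (simp add: N)
    finally show ?thesis .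
  qed
  have "a * (lam * (a - 1)) = (\<Sum>j\<in>{1..k}. count (tips (M j)) None)"
    using count_tips[OF k _ M, of None] a by (simp add: demand_def count_sum)
  also have "\<dots> \<le> (\<Sum>j\<in>{1..k}. 2 * (a - 1))"
    by (intro sum_mono None)
  finally have "(a * lam) * (a - 1) \<le> (2 * k) * (a - 1)"
    by (simp add: mult_ac)
  then have "a * lam \<le> lam * (a - 1) + mu * a * p"
    using a k by simp
  moreover have "a * lam = lam * (a - 1) + lam"
    using a by (cases a) simp_all
  ultimately show ?thesis by linarith
qed

theorem corollary1:
  fixes a p k lam mu :: nat
    and c :: "(nat \<times> nat) set \<times> nat \<Rightarrow> nat"
  assumes "a > 1" and "p \<ge> 1" and "k \<ge> 1" and "mu \<ge> 1" and "lam \<noteq> mu"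
    and "edge_coloring (K a p lam mu) k c"
  shows "embeddable (K a p lam mu) k c (K a (p + 1) lam mu) \<longleftrightarrow>
      real k = (real lam * (real a - 1) + real mu * real a * real p) / 2 \<and>
      lam \<le> mu * a * p \<and>
      (\<forall>j\<in>{1..k}. \<forall>H\<in>components (color_class (K a p lam mu) c j). is_path H) \<and>
      (\<forall>j\<in>{1..k}. num_components (color_class (K a p lam mu) c j) \<le> a)"
proof -
  have i: "real k = (real lam * (real a - 1) + real mu * real a * real p) / 2 \<longleftrightarrow>
      2 * k = lam * (a - 1) + mu * a * p"
  proof -
    have "real (a - 1) = real a - 1"
      using assms(1) by simp
    then have *: "real (lam * (a - 1) + mu * a * p) = real lam * (real a - 1) + real mu * real a * real p"
      unfolding of_nat_add of_nat_mult by simp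
    have "x = y / 2 \<longleftrightarrow> 2 * x = y" for x y :: real
      by auto
    then have "real k = (real lam * (real a - 1) + real mu * real a * real p) / 2 \<longleftrightarrow>
        real (2 * k) = real (lam * (a - 1) + mu * a * p)"
      unfolding * by simp
    then show ?thesis
      unfolding of_nat_eq_iff .
  qed
  define systems where "systems M \<longleftrightarrow> (\<forall>j\<in>{1..k}. size (M j) = a \<and> cover (M j) = mset_set (grown a p 0) \<and>
      linkage (M j) = image_mset fst (mset_set {e \<in> edges (K a p lam mu). c e = j}))" for M
  have "(\<forall>j\<in>{1..k}. \<forall>H\<in>components (color_class (K a p lam mu) c j). is_path H) \<and>
      (\<forall>j\<in>{1..k}. num_components (color_class (K a p lam mu) c j) \<le> a) \<longleftrightarrow>
    (\<forall>j\<in>{1..k}. \<exists>M. size M = a \<and> cover M = mset_set (grown a p 0) \<and>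
      linkage M = image_mset fst (mset_set {e \<in> edges (K a p lam mu). c e = j}))"
    unfolding linear_forest_iff_path_system_color_class[symmetric] by blast
  also have "\<dots> \<longleftrightarrow> (\<exists>M. systems M)"
    unfolding systems_def by (rule bchoice_iff)
  finally have iii_iv: "(\<forall>j\<in>{1..k}. \<forall>H\<in>components (color_class (K a p lam mu) c j). is_path H) \<and>
      (\<forall>j\<in>{1..k}. num_components (color_class (K a p lam mu) c j) \<le> a) \<longleftrightarrow> (\<exists>M. systems M)" .
  have decomposition: "path_decomposition a p lam mu k 0 M" if "systems M" for M
    using that assms(6) sum_color_classes[OF finite_edges_K, of a p lam mu c k fst]
    by (simp add: systems_def path_decomposition_def grown_edges_0 edge_coloring_def)
  show ?thesis
    unfolding i iii_iv
  proof (intro iffI conjI; (elim conjE exE)?)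
    assume emb: "embeddable (K a p lam mu) k c (K a (p + 1) lam mu)"
    show k: "2 * k = lam * (a - 1) + mu * a * p"
      using path_decomposition_if_embeddable(1) emb assms(1,2) by simp
    show M: "\<exists>M. systems M"
      unfolding systems_def using path_decomposition_if_embeddable(2) emb assms(1,2) by simp
    show "lam \<le> mu * a * p"
      using M lam_le_of_path_decomposition[OF k] decomposition assms(1,2) by auto
  next
    fix M assume k: "2 * k = lam * (a - 1) + mu * a * p" and M: "systems M"
    have "linkage (M j) = image_mset fst (mset_set {e \<in> edges (K a p lam mu). c e = j})"
      if "j \<in> {1..k}" for j
      using M that unfolding systems_def by blast
    with embeddable_if_path_decomposition[OF k _ _ assms(6) decomposition[OF M]] assms(1,2)
    show "embeddable (K a p lam mu) k c (K a (p + 1) lam mu)"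
      by simp
  qed
qed

end
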